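(* Let $\mathbf{C}$ be an a.s.-compatibly representable Markov category with associated monad $(P,\mu,\delta)$ on $\mathbf{C}_{\mathrm{det}}$. Suppose that $\mathbf{C}$ has conditionals and satisfies the equalizer principle. Then the monad $(P,\mu,\delta)$ has weakly cartesian functor and weakly cartesian multiplication.
   Context: A Markov category is a symmetric monoidal category $(\mathbf{C},\otimes,I)$ (coherence isomorphisms suppressed) in which every object $X$ carries a distinguished commutative comonoid structure $\mathrm{copy}_X:X\to X\otimes X$, $\mathrm{del}_X:X\to I$, compatible with the tensor product, and such that $\mathrm{del}_Y\circ f=\mathrm{del}_X$ for every $f:X\to Y$ (equivalently, $I$ is terminal). A morphism $f:A\to X$ is deterministic if $\mathrm{copy}_X\circ f=(f\otimes f)\circ\mathrm{copy}_A$; $\mathbf{C}_{\mathrm{det}}$ is the subcategory of all objects and deterministic morphisms. Conditionals: a conditional of $f:A\to X\otimes Y$ with respect to $X$ is a morphism $f|_X:X\otimes A\to Y$ with $f=(\mathrm{id}_X\otimes f|_X)\circ(\mathrm{copy}_X\otimes \mathrm{id}_A)\circ(f_X\otimes \mathrm{id}_A)\circ\mathrm{copy}_A$, where $f_X=(\mathrm{id}_X\otimes\mathrm{del}_Y)\circ f$. $\mathbf{C}$ has conditionals if every morphism admits a conditional with respect to any of its outputs. Almost sure equality: for $p:A\to X$ and $f,g:X\to Y$, write $f=_{p}g$ if $(\mathrm{id}_X\otimes f)\circ\mathrm{copy}_X\circ p=(\mathrm{id}_X\otimes g)\circ\mathrm{copy}_X\circ p$. Equalizer principle: (i) equalizers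 in $\mathbf{C}_{\mathrm{det}}$ exist; (ii) for every equalizer $\mathrm{eq}:E\to X$ in $\mathbf{C}_{\mathrm{det}}$ of deterministic $f,g:X\to Y$, every $p:A\to X$ in $\mathbf{C}$ with $f=_p g$ factors uniquely across $\mathrm{eq}$, i.e. there is a unique $r:A\to E$ in $\mathbf{C}$ with $\mathrm{eq}\circ r=p$. Representability: a distribution object for $X$ is an object $PX$ with a morphism $\mathrm{samp}_X:PX\to X$ such that $\mathrm{samp}_X\circ-:\mathbf{C}_{\mathrm{det}}(A,PX)\to\mathbf{C}(A,X)$ is a bijection for every $A$; its inverse is denoted $f\mapsto f^\#$, and $\delta_X:=(1_X)^\#:X\to PX$. $\mathbf{C}$ is representable if every object has a distribution object. Then $P$ becomes a functor $\mathbf{C}\to\mathbf{C}_{\mathrm{det}}$, $Pf=(f\circ\mathrm{samp}_X)^\#$ for $f:X\to Y$, right adjoint to the inclusion $\mathbf{C}_{\mathrm{det}}\hookrightarrow\mathbf{C}$ with unit $\delta$ and counit $\mathrm{samp}$; the associated monad on $\mathbf{C}_{\mathrm{det}}$ is $(P,\mu,\delta)$ with $\mu_X=P(\mathrm{samp}_X)$. $\mathbf{C}$ is a.s.-compatibly representable if it is representable and, for every $p:\Theta\to A$ and all $f,g:A\to X$, $f^\#=_{p}g^\#$ if and only if $f=_{p}g$. Weak pullback: a commutative square $m\circ f=n\circ g$ (with $f:A\to B$, $g:A\to C$, $m:B\to D$, $n:C\to D$) is a weak pullback if for every object $S$ and all $q:S\to B$, $p:S\to C$ with $m\circ q=n\circ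 p$ there is a (not necessarily unique) $r:S\to A$ with $f\circ r=q$ and $g\circ r=p$. The functor $T$ of a monad $(T,\mu,\eta)$ is weakly cartesian if it preserves weak pullbacks; $\mu$ is weakly cartesian if all its naturality squares ($\mu_Y\circ TTf=Tf\circ\mu_X$ for $f:X\to Y$) are weak pullbacks. *)

theory Defs
  imports Main
begin

record ('o, 'm) category =
  Obj :: "'o set"
  Arr :: "'m set"
  Dom :: "'m \<Rightarrow> 'o"
  Cod :: "'m \<Rightarrow> 'o"
  Ident :: "'o \<Rightarrow> 'm"
  Comp :: "'m \<Rightarrow> 'm \<Rightarrow> 'm"  (infixr "\<cdot>\<index>" 55)

definition Hom :: "('o, 'm, 'e) category_scheme \<Rightarrow> 'o \<Rightarrow> 'o \<Rightarrow> 'm set" where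
  "Hom C A B = {f \<in> Arr C. Dom C f = A \<and> Cod C f = B}"

locale category =
  fixes C :: "('o, 'm, 'e) category_scheme" (structure)
  assumes Dom_Obj: "f \<in> Arr C \<Longrightarrow> Dom C f \<in> Obj C"
    and Cod_Obj: "f \<in> Arr C \<Longrightarrow> Cod C f \<in> Obj C"
    and Ident_Hom: "A \<in> Obj C \<Longrightarrow> Ident C A \<in> Hom C A A"
    and Comp_Hom: "\<lbrakk>f \<in> Hom C A B; g \<in> Hom C B D\<rbrakk> \<Longrightarrow> g \<cdot> f \<in> Hom C A D"
    and Ident_left: "f \<in> Hom C A B \<Longrightarrow> Ident C B \<cdot> f = f"
    and Ident_right: "f \<in> Hom C A B \<Longrightarrow> f \<cdot> Ident C A = f"
    and Comp_assoc: "\<lbrakk>f \<in> Hom C A B; g \<in> Hom C B D; h \<in> Hom C D E\<rbrakk>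
          \<Longrightarrow> (h \<cdot> g) \<cdot> f = h \<cdot> (g \<cdot> f)"

definition inverse_arrows :: "('o, 'm, 'e) category_scheme \<Rightarrow> 'm \<Rightarrow> 'm \<Rightarrow> bool" where
  "inverse_arrows C f g \<longleftrightarrow>
     f \<in> Arr C \<and> g \<in> Hom C (Cod C f) (Dom C f) \<and>
     g \<cdot>\<^bsub>C\<^esub> f = Ident C (Dom C f) \<and> f \<cdot>\<^bsub>C\<^esub> g = Ident C (Cod C f)"

definition is_iso :: "('o, 'm, 'e) category_scheme \<Rightarrow> 'm \<Rightarrow> bool" where
  "is_iso C f \<longleftrightarrow> (\<exists>g. inverse_arrows C f g)"

definition inv_arr :: "('o, 'm, 'e) category_scheme \<Rightarrow> 'm \<Rightarrow> 'm" where
  "inv_arr C f = (THE g. inverse_arrows C f g)"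

definition is_equalizer ::
  "('o, 'm, 'e) category_scheme \<Rightarrow> 'o \<Rightarrow> 'o \<Rightarrow> 'm \<Rightarrow> 'm \<Rightarrow> 'o \<Rightarrow> 'm \<Rightarrow> bool" where
  "is_equalizer K X Y f g E eq \<longleftrightarrow>
     f \<in> Hom K X Y \<and> g \<in> Hom K X Y \<and> E \<in> Obj K \<and> eq \<in> Hom K E X \<and>
     f \<cdot>\<^bsub>K\<^esub> eq = g \<cdot>\<^bsub>K\<^esub> eq \<and>
     (\<forall>A \<in> Obj K. \<forall>h \<in> Hom K A X. f \<cdot>\<^bsub>K\<^esub> h = g \<cdot>\<^bsub>K\<^esub> h
        \<longrightarrow> (\<exists>!r. r \<in> Hom K A E \<and> eq \<cdot>\<^bsub>K\<^esub> r = h))"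

definition has_equalizers :: "('o, 'm, 'e) category_scheme \<Rightarrow> bool" where
  "has_equalizers K \<longleftrightarrow>
     (\<forall>X \<in> Obj K. \<forall>Y \<in> Obj K. \<forall>f \<in> Hom K X Y. \<forall>g \<in> Hom K X Y.
        \<exists>E eq. is_equalizer K X Y f g E eq)"

text \<open>The square \<open>m \<cdot> f = n \<cdot> g\<close> with apex \<open>A\<close> is a weak pullback of the cospan \<open>m\<close>, \<open>n\<close>.\<close>

definition weak_pullback ::
  "('o, 'm, 'e) category_scheme \<Rightarrow> 'm \<Rightarrow> 'm \<Rightarrow> 'm \<Rightarrow> 'm \<Rightarrow> bool" where
  "weak_pullback K f g m n \<longleftrightarrow>
     (\<exists>A B C D. f \<in> Hom K A B \<and> g \<in> Hom K A C \<and> m \<in> Hom K B D \<and> n \<in> Hom K C D \<and>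
        m \<cdot>\<^bsub>K\<^esub> f = n \<cdot>\<^bsub>K\<^esub> g \<and>
        (\<forall>S \<in> Obj K. \<forall>q \<in> Hom K S B. \<forall>p \<in> Hom K S C. m \<cdot>\<^bsub>K\<^esub> q = n \<cdot>\<^bsub>K\<^esub> p
           \<longrightarrow> (\<exists>r \<in> Hom K S A. f \<cdot>\<^bsub>K\<^esub> r = q \<and> g \<cdot>\<^bsub>K\<^esub> r = p)))"

record ('o, 'm) monad =
  FunO :: "'o \<Rightarrow> 'o"
  FunA :: "'m \<Rightarrow> 'm"
  Mult :: "'o \<Rightarrow> 'm"
  Unit :: "'o \<Rightarrow> 'm"

locale monad = category K for K :: "('o, 'm, 'e) category_scheme" (structure) +
  fixes T :: "('o, 'm) monad"
  assumes FunO_Obj: "X \<in> Obj K \<Longrightarrow> FunO T X \<in> Obj K"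
    and FunA_Hom: "f \<in> Hom K X Y \<Longrightarrow> FunA T f \<in> Hom K (FunO T X) (FunO T Y)"
    and FunA_Ident: "X \<in> Obj K \<Longrightarrow> FunA T (Ident K X) = Ident K (FunO T X)"
    and FunA_Comp: "\<lbrakk>f \<in> Hom K X Y; g \<in> Hom K Y Z\<rbrakk>
          \<Longrightarrow> FunA T (g \<cdot> f) = FunA T g \<cdot> FunA T f"
    and Mult_Hom: "X \<in> Obj K \<Longrightarrow> Mult T X \<in> Hom K (FunO T (FunO T X)) (FunO T X)"
    and Unit_Hom: "X \<in> Obj K \<Longrightarrow> Unit T X \<in> Hom K X (FunO T X)"
    and Mult_natural: "f \<in> Hom K X Y
          \<Longrightarrow> Mult T Y \<cdot> FunA T (FunA T f) = FunA T f \<cdot> Mult T X"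
    and Unit_natural: "f \<in> Hom K X Y \<Longrightarrow> Unit T Y \<cdot> f = FunA T f \<cdot> Unit T X"
    and Mult_assoc: "X \<in> Obj K
          \<Longrightarrow> Mult T X \<cdot> FunA T (Mult T X) = Mult T X \<cdot> Mult T (FunO T X)"
    and Mult_Unit_left: "X \<in> Obj K \<Longrightarrow> Mult T X \<cdot> Unit T (FunO T X) = Ident K (FunO T X)"
    and Mult_Unit_right: "X \<in> Obj K \<Longrightarrow> Mult T X \<cdot> FunA T (Unit T X) = Ident K (FunO T X)"

definition weakly_cartesian_functor ::
  "('o, 'm, 'e) category_scheme \<Rightarrow> ('o, 'm) monad \<Rightarrow> bool" where
  "weakly_cartesian_functor K T \<longleftrightarrow>
     (\<forall>f g m n. weak_pullback K f g m n
        \<longrightarrow> weak_pullback K (FunA T f) (FunA T g) (FunA T m) (FunA T n))"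

definition weakly_cartesian_mult ::
  "('o, 'm, 'e) category_scheme \<Rightarrow> ('o, 'm) monad \<Rightarrow> bool" where
  "weakly_cartesian_mult K T \<longleftrightarrow>
     (\<forall>X \<in> Obj K. \<forall>Y \<in> Obj K. \<forall>f \<in> Hom K X Y.
        weak_pullback K (FunA T (FunA T f)) (Mult T X) (Mult T Y) (FunA T f))"

text \<open>
  Monoidal categories are not assumed to be strict, so the coherence isomorphisms that are
  usually suppressed appear explicitly:
  \<open>Assoc X Y Z : (X \<otimes> Y) \<otimes> Z \<rightarrow> X \<otimes> (Y \<otimes> Z)\<close>, \<open>LUnit X : I \<otimes> X \<rightarrow> X\<close>,
  \<open>RUnit X : X \<otimes> I \<rightarrow> X\<close>. The symmetry is \<open>Swap X Y : X \<otimes> Y \<rightarrow> Y \<otimes> X\<close>.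
\<close>

record ('o, 'm) markov_category = "('o, 'm) category" +
  TensO :: "'o \<Rightarrow> 'o \<Rightarrow> 'o"  (infixr "\<otimes>\<^sub>o\<index>" 70)
  TensA :: "'m \<Rightarrow> 'm \<Rightarrow> 'm"  (infixr "\<otimes>\<index>" 70)
  UnitO :: "'o"
  Assoc :: "'o \<Rightarrow> 'o \<Rightarrow> 'o \<Rightarrow> 'm"
  LUnit :: "'o \<Rightarrow> 'm"
  RUnit :: "'o \<Rightarrow> 'm"
  Swap :: "'o \<Rightarrow> 'o \<Rightarrow> 'm"
  Copy :: "'o \<Rightarrow> 'm"
  Del :: "'o \<Rightarrow> 'm"

locale symmetric_monoidal_category = category C
  for C :: "('o, 'm, 'e) markov_category_scheme" (structure) +
  assumes TensO_Obj: "\<lbrakk>X \<in> Obj C; Y \<in> Obj C\<rbrakk> \<Longrightarrow> X \<otimes>\<^sub>o Y \<in> Obj C"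
    and UnitO_Obj: "UnitO C \<in> Obj C"
    and TensA_Hom: "\<lbrakk>f \<in> Hom C X X'; g \<in> Hom C Y Y'\<rbrakk>
          \<Longrightarrow> f \<otimes> g \<in> Hom C (X \<otimes>\<^sub>o Y) (X' \<otimes>\<^sub>o Y')"
    and TensA_Ident: "\<lbrakk>X \<in> Obj C; Y \<in> Obj C\<rbrakk>
          \<Longrightarrow> Ident C X \<otimes> Ident C Y = Ident C (X \<otimes>\<^sub>o Y)"
    and TensA_Comp: "\<lbrakk>f \<in> Hom C X X'; f' \<in> Hom C X' X''; g \<in> Hom C Y Y'; g' \<in> Hom C Y' Y''\<rbrakk>
          \<Longrightarrow> (f' \<cdot> f) \<otimes> (g' \<cdot> g) = (f' \<otimes> g') \<cdot> (f \<otimes> g)"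
    and Assoc_Hom: "\<lbrakk>X \<in> Obj C; Y \<in> Obj C; Z \<in> Obj C\<rbrakk>
          \<Longrightarrow> Assoc C X Y Z \<in> Hom C ((X \<otimes>\<^sub>o Y) \<otimes>\<^sub>o Z) (X \<otimes>\<^sub>o (Y \<otimes>\<^sub>o Z))"
    and Assoc_iso: "\<lbrakk>X \<in> Obj C; Y \<in> Obj C; Z \<in> Obj C\<rbrakk> \<Longrightarrow> is_iso C (Assoc C X Y Z)"
    and Assoc_natural: "\<lbrakk>f \<in> Hom C X X'; g \<in> Hom C Y Y'; h \<in> Hom C Z Z'\<rbrakk>
          \<Longrightarrow> Assoc C X' Y' Z' \<cdot> ((f \<otimes> g) \<otimes> h) = (f \<otimes> (g \<otimes> h)) \<cdot> Assoc C X Y Z"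
    and LUnit_Hom: "X \<in> Obj C \<Longrightarrow> LUnit C X \<in> Hom C (UnitO C \<otimes>\<^sub>o X) X"
    and LUnit_iso: "X \<in> Obj C \<Longrightarrow> is_iso C (LUnit C X)"
    and LUnit_natural: "f \<in> Hom C X Y
          \<Longrightarrow> LUnit C Y \<cdot> (Ident C (UnitO C) \<otimes> f) = f \<cdot> LUnit C X"
    and RUnit_Hom: "X \<in> Obj C \<Longrightarrow> RUnit C X \<in> Hom C (X \<otimes>\<^sub>o UnitO C) X"
    and RUnit_iso: "X \<in> Obj C \<Longrightarrow> is_iso C (RUnit C X)"
    and RUnit_natural: "f \<in> Hom C X Y
          \<Longrightarrow> RUnit C Y \<cdot> (f \<otimes> Ident C (UnitO C)) = f \<cdot> RUnit C X"
    and triangle: "\<lbrakk>X \<in> Obj C; Y \<in> Obj C\<rbrakk>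
          \<Longrightarrow> (Ident C X \<otimes> LUnit C Y) \<cdot> Assoc C X (UnitO C) Y = RUnit C X \<otimes> Ident C Y"
    and pentagon: "\<lbrakk>W \<in> Obj C; X \<in> Obj C; Y \<in> Obj C; Z \<in> Obj C\<rbrakk>
          \<Longrightarrow> (Ident C W \<otimes> Assoc C X Y Z) \<cdot> Assoc C W (X \<otimes>\<^sub>o Y) Z \<cdot> (Assoc C W X Y \<otimes> Ident C Z)
            = Assoc C W X (Y \<otimes>\<^sub>o Z) \<cdot> Assoc C (W \<otimes>\<^sub>o X) Y Z"
    and Swap_Hom: "\<lbrakk>X \<in> Obj C; Y \<in> Obj C\<rbrakk> \<Longrightarrow> Swap C X Y \<in> Hom C (X \<otimes>\<^sub>o Y) (Y \<otimes>\<^sub>o X)"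
    and Swap_natural: "\<lbrakk>f \<in> Hom C X X'; g \<in> Hom C Y Y'\<rbrakk>
          \<Longrightarrow> Swap C X' Y' \<cdot> (f \<otimes> g) = (g \<otimes> f) \<cdot> Swap C X Y"
    and Swap_Swap: "\<lbrakk>X \<in> Obj C; Y \<in> Obj C\<rbrakk>
          \<Longrightarrow> Swap C Y X \<cdot> Swap C X Y = Ident C (X \<otimes>\<^sub>o Y)"
    and hexagon: "\<lbrakk>X \<in> Obj C; Y \<in> Obj C; Z \<in> Obj C\<rbrakk>
          \<Longrightarrow> Assoc C Y Z X \<cdot> Swap C X (Y \<otimes>\<^sub>o Z) \<cdot> Assoc C X Y Z
            = (Ident C Y \<otimes> Swap C X Z) \<cdot> Assoc C Y X Z \<cdot> (Swap C X Y \<otimes> Ident C Z)"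

text \<open>The canonical isomorphism \<open>(X \<otimes> X') \<otimes> (Y \<otimes> Y') \<rightarrow> (X \<otimes> Y) \<otimes> (X' \<otimes> Y')\<close>, that is,
  \<open>id \<otimes> Swap X' Y \<otimes> id\<close> up to associators.\<close>

definition Interchange ::
  "('o, 'm, 'e) markov_category_scheme \<Rightarrow> 'o \<Rightarrow> 'o \<Rightarrow> 'o \<Rightarrow> 'o \<Rightarrow> 'm" where
  "Interchange C X X' Y Y' =
     inv_arr C (Assoc C X Y (X' \<otimes>\<^sub>o\<^bsub>C\<^esub> Y'))
     \<cdot>\<^bsub>C\<^esub> (Ident C X \<otimes>\<^bsub>C\<^esub>
            (Assoc C Y X' Y' \<cdot>\<^bsub>C\<^esub> (Swap C X' Y \<otimes>\<^bsub>C\<^esub> Ident C Y') \<cdot>\<^bsub>C\<^esub> inv_arr C (Assoc C X' Y Y')))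
     \<cdot>\<^bsub>C\<^esub> Assoc C X X' (Y \<otimes>\<^sub>o\<^bsub>C\<^esub> Y')"

locale markov_category = symmetric_monoidal_category C
  for C :: "('o, 'm, 'e) markov_category_scheme" (structure) +
  assumes Copy_Hom: "X \<in> Obj C \<Longrightarrow> Copy C X \<in> Hom C X (X \<otimes>\<^sub>o X)"
    and Del_Hom: "X \<in> Obj C \<Longrightarrow> Del C X \<in> Hom C X (UnitO C)"
    and Copy_coassoc: "X \<in> Obj C
          \<Longrightarrow> Assoc C X X X \<cdot> (Copy C X \<otimes> Ident C X) \<cdot> Copy C X
            = (Ident C X \<otimes> Copy C X) \<cdot> Copy C X"
    and Copy_counit_left: "X \<in> Obj C
          \<Longrightarrow> LUnit C X \<cdot> (Del C X \<otimes> Ident C X) \<cdot> Copy C X = Ident C X"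
    and Copy_counit_right: "X \<in> Obj C
          \<Longrightarrow> RUnit C X \<cdot> (Ident C X \<otimes> Del C X) \<cdot> Copy C X = Ident C X"
    and Copy_commutative: "X \<in> Obj C \<Longrightarrow> Swap C X X \<cdot> Copy C X = Copy C X"
    and Copy_TensO: "\<lbrakk>X \<in> Obj C; Y \<in> Obj C\<rbrakk>
          \<Longrightarrow> Copy C (X \<otimes>\<^sub>o Y) = Interchange C X X Y Y \<cdot> (Copy C X \<otimes> Copy C Y)"
    and Copy_UnitO: "Copy C (UnitO C) = inv_arr C (LUnit C (UnitO C))"
    and Del_TensO: "\<lbrakk>X \<in> Obj C; Y \<in> Obj C\<rbrakk>
          \<Longrightarrow> Del C (X \<otimes>\<^sub>o Y) = LUnit C (UnitO C) \<cdot> (Del C X \<otimes> Del C Y)"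
    and Del_UnitO: "Del C (UnitO C) = Ident C (UnitO C)"
    and Del_natural: "f \<in> Hom C X Y \<Longrightarrow> Del C Y \<cdot> f = Del C X"

definition deterministic :: "('o, 'm, 'e) markov_category_scheme \<Rightarrow> 'm \<Rightarrow> bool" where
  "deterministic C f \<longleftrightarrow>
     f \<in> Arr C \<and> Copy C (Cod C f) \<cdot>\<^bsub>C\<^esub> f = (f \<otimes>\<^bsub>C\<^esub> f) \<cdot>\<^bsub>C\<^esub> Copy C (Dom C f)"

definition det :: "('o, 'm, 'e) markov_category_scheme \<Rightarrow> ('o, 'm) category" where
  "det C = \<lparr>Obj = Obj C, Arr = {f. deterministic C f}, Dom = Dom C, Cod = Cod C,
            Ident = Ident C, Comp = Comp C\<rparr>"

definition marginal1 ::
  "('o, 'm, 'e) markov_category_scheme \<Rightarrow> 'o \<Rightarrow> 'o \<Rightarrow> 'm \<Rightarrow> 'm" where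
  "marginal1 C X Y f = RUnit C X \<cdot>\<^bsub>C\<^esub> (Ident C X \<otimes>\<^bsub>C\<^esub> Del C Y) \<cdot>\<^bsub>C\<^esub> f"

definition is_conditional ::
  "('o, 'm, 'e) markov_category_scheme \<Rightarrow> 'o \<Rightarrow> 'o \<Rightarrow> 'o \<Rightarrow> 'm \<Rightarrow> 'm \<Rightarrow> bool" where
  "is_conditional C A X Y f c \<longleftrightarrow>
     c \<in> Hom C (X \<otimes>\<^sub>o\<^bsub>C\<^esub> A) Y \<and>
     f = (Ident C X \<otimes>\<^bsub>C\<^esub> c) \<cdot>\<^bsub>C\<^esub> Assoc C X X A \<cdot>\<^bsub>C\<^esub> (Copy C X \<otimes>\<^bsub>C\<^esub> Ident C A)
           \<cdot>\<^bsub>C\<^esub> (marginal1 C X Y f \<otimes>\<^bsub>C\<^esub> Ident C A) \<cdot>\<^bsub>C\<^esub> Copy C A"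

text \<open>A conditional of \<open>f : A \<rightarrow> X \<otimes> Y\<close> with respect to the second output is a conditional of
  \<open>Swap X Y \<cdot> f\<close> with respect to \<open>Y\<close>, so it suffices to quantify over first outputs.\<close>

definition has_conditionals :: "('o, 'm, 'e) markov_category_scheme \<Rightarrow> bool" where
  "has_conditionals C \<longleftrightarrow>
     (\<forall>A \<in> Obj C. \<forall>X \<in> Obj C. \<forall>Y \<in> Obj C. \<forall>f \<in> Hom C A (X \<otimes>\<^sub>o\<^bsub>C\<^esub> Y).
        \<exists>c. is_conditional C A X Y f c)"

definition as_eq ::
  "('o, 'm, 'e) markov_category_scheme \<Rightarrow> 'o \<Rightarrow> 'm \<Rightarrow> 'm \<Rightarrow> 'm \<Rightarrow> bool" where
  "as_eq C X p f g \<longleftrightarrow>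
     (Ident C X \<otimes>\<^bsub>C\<^esub> f) \<cdot>\<^bsub>C\<^esub> Copy C X \<cdot>\<^bsub>C\<^esub> p = (Ident C X \<otimes>\<^bsub>C\<^esub> g) \<cdot>\<^bsub>C\<^esub> Copy C X \<cdot>\<^bsub>C\<^esub> p"

definition equalizer_principle :: "('o, 'm, 'e) markov_category_scheme \<Rightarrow> bool" where
  "equalizer_principle C \<longleftrightarrow>
     has_equalizers (det C) \<and>
     (\<forall>X Y f g E eq. is_equalizer (det C) X Y f g E eq \<longrightarrow>
        (\<forall>A \<in> Obj C. \<forall>p \<in> Hom C A X. as_eq C X p f g
           \<longrightarrow> (\<exists>!r. r \<in> Hom C A E \<and> eq \<cdot>\<^bsub>C\<^esub> r = p)))"

definition distribution_object ::
  "('o, 'm, 'e) markov_category_scheme \<Rightarrow> 'o \<Rightarrow> 'o \<Rightarrow> 'm \<Rightarrow> bool" where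
  "distribution_object C X PX s \<longleftrightarrow>
     PX \<in> Obj C \<and> s \<in> Hom C PX X \<and>
     (\<forall>A \<in> Obj C. bij_betw (\<lambda>g. s \<cdot>\<^bsub>C\<^esub> g) (Hom (det C) A PX) (Hom C A X))"

text \<open>A choice of a distribution object \<open>P X\<close> with sampling map \<open>samp X\<close> for every object \<open>X\<close>.
  The monad is determined by \<open>C\<close> only up to this choice.\<close>

definition represented_by ::
  "('o, 'm, 'e) markov_category_scheme \<Rightarrow> ('o \<Rightarrow> 'o) \<Rightarrow> ('o \<Rightarrow> 'm) \<Rightarrow> bool" where
  "represented_by C P samp \<longleftrightarrow> (\<forall>X \<in> Obj C. distribution_object C X (P X) (samp X))"

definition sharp ::
  "('o, 'm, 'e) markov_category_scheme \<Rightarrow> ('o \<Rightarrow> 'o) \<Rightarrow> ('o \<Rightarrow> 'm) \<Rightarrow> 'm \<Rightarrow> 'm" where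
  "sharp C P samp f =
     (THE g. g \<in> Hom (det C) (Dom C f) (P (Cod C f)) \<and> samp (Cod C f) \<cdot>\<^bsub>C\<^esub> g = f)"

definition as_compatibly_represented_by ::
  "('o, 'm, 'e) markov_category_scheme \<Rightarrow> ('o \<Rightarrow> 'o) \<Rightarrow> ('o \<Rightarrow> 'm) \<Rightarrow> bool" where
  "as_compatibly_represented_by C P samp \<longleftrightarrow>
     represented_by C P samp \<and>
     (\<forall>\<Theta> \<in> Obj C. \<forall>A \<in> Obj C. \<forall>X \<in> Obj C.
        \<forall>p \<in> Hom C \<Theta> A. \<forall>f \<in> Hom C A X. \<forall>g \<in> Hom C A X.
          as_eq C A p (sharp C P samp f) (sharp C P samp g) \<longleftrightarrow> as_eq C A p f g)"

definition dist_map ::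
  "('o, 'm, 'e) markov_category_scheme \<Rightarrow> ('o \<Rightarrow> 'o) \<Rightarrow> ('o \<Rightarrow> 'm) \<Rightarrow> 'm \<Rightarrow> 'm" where
  "dist_map C P samp f = sharp C P samp (f \<cdot>\<^bsub>C\<^esub> samp (Dom C f))"

definition dist_monad ::
  "('o, 'm, 'e) markov_category_scheme \<Rightarrow> ('o \<Rightarrow> 'o) \<Rightarrow> ('o \<Rightarrow> 'm) \<Rightarrow> ('o, 'm) monad" where
  "dist_monad C P samp =
     \<lparr>FunO = P, FunA = dist_map C P samp,
      Mult = (\<lambda>X. dist_map C P samp (samp X)),
      Unit = (\<lambda>X. sharp C P samp (Ident C X))\<rparr>"

lemma HomI: "\<lbrakk>f \<in> Arr C; Dom C f = A; Cod C f = B\<rbrakk> \<Longrightarrow> f \<in> Hom C A B"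
  by (simp add: Hom_def)

lemma det_simps [simp]:
  "Obj (det C) = Obj C" "Dom (det C) = Dom C" "Cod (det C) = Cod C"
  "Ident (det C) = Ident C" "Comp (det C) = Comp C"
  by (simp_all add: det_def)

lemma Hom_det: "f \<in> Hom (det C) A B \<longleftrightarrow>
    f \<in> Hom C A B \<and> Copy C B \<cdot>\<^bsub>C\<^esub> f = (f \<otimes>\<^bsub>C\<^esub> f) \<cdot>\<^bsub>C\<^esub> Copy C A"
  by (auto simp: Hom_def det_def deterministic_def)

context markov_category
begin

lemma Hom_Obj: "f \<in> Hom C A B \<Longrightarrow> A \<in> Obj C" "f \<in> Hom C A B \<Longrightarrow> B \<in> Obj C"
  using Dom_Obj Cod_Obj by (auto simp: Hom_def)

lemma det_Comp_Hom:
  assumes f: "f \<in> Hom (det C) A B" and g: "g \<in> Hom (det C) B D"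
  shows "g \<cdot> f \<in> Hom (det C) A D"
proof -
  have f': "f \<in> Hom C A B" "Copy C B \<cdot> f = (f \<otimes> f) \<cdot> Copy C A"
    and g': "g \<in> Hom C B D" "Copy C D \<cdot> g = (g \<otimes> g) \<cdot> Copy C B"
    using f g by (auto simp: Hom_det)
  have A: "A \<in> Obj C" and B: "B \<in> Obj C" and D: "D \<in> Obj C"
    using f' g' Hom_Obj by blast+
  have ff: "f \<otimes> f \<in> Hom C (A \<otimes>\<^sub>o A) (B \<otimes>\<^sub>o B)" and gg: "g \<otimes> g \<in> Hom C (B \<otimes>\<^sub>o B) (D \<otimes>\<^sub>o D)"
    using TensA_Hom f' g' by blast+
  have "Copy C D \<cdot> (g \<cdot> f) = (Copy C D \<cdot> g) \<cdot> f"
    using Comp_assoc[OF f'(1) g'(1) Copy_Hom[OF D]] by simp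
  also have "\<dots> = (g \<otimes> g) \<cdot> (Copy C B \<cdot> f)"
    using g'(2) Comp_assoc[OF f'(1) Copy_Hom[OF B] gg] by simp
  also have "\<dots> = ((g \<otimes> g) \<cdot> (f \<otimes> f)) \<cdot> Copy C A"
    using f'(2) Comp_assoc[OF Copy_Hom[OF A] ff gg] by simp
  also have "(g \<otimes> g) \<cdot> (f \<otimes> f) = (g \<cdot> f) \<otimes> (g \<cdot> f)"
    using TensA_Comp[OF f'(1) g'(1) f'(1) g'(1)] by simp
  finally show ?thesis
    using Comp_Hom[OF f'(1) g'(1)] by (simp add: Hom_det)
qed

lemma category_det: "category (det C)"
proof
  fix A assume A: "A \<in> Obj (det C)"
  then have A': "A \<in> Obj C" by simp
  have "Copy C A \<cdot> Ident C A = (Ident C A \<otimes> Ident C A) \<cdot> Copy C A"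
    using Ident_left[OF Copy_Hom[OF A']] Ident_right[OF Copy_Hom[OF A']] TensA_Ident[OF A' A']
    by simp
  then show "Ident (det C) A \<in> Hom (det C) A A"
    using Ident_Hom[OF A'] by (simp add: Hom_det)
next
  fix f A B g D
  assume "f \<in> Hom (det C) A B" "g \<in> Hom (det C) B D"
  then show "g \<cdot>\<^bsub>det C\<^esub> f \<in> Hom (det C) A D"
    using det_Comp_Hom by simp
next
  fix f A B g D h E
  assume "f \<in> Hom (det C) A B" "g \<in> Hom (det C) B D" "h \<in> Hom (det C) D E"
  then show "(h \<cdot>\<^bsub>det C\<^esub> g) \<cdot>\<^bsub>det C\<^esub> f = h \<cdot>\<^bsub>det C\<^esub> (g \<cdot>\<^bsub>det C\<^esub> f)"
    using Comp_assoc by (auto simp: Hom_det)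
next
  fix f A B
  assume "f \<in> Hom (det C) A B"
  then have f: "f \<in> Hom C A B" by (simp add: Hom_det)
  show "Ident (det C) B \<cdot>\<^bsub>det C\<^esub> f = f"
    using Ident_left[OF f] by simp
  show "f \<cdot>\<^bsub>det C\<^esub> Ident (det C) A = f"
    using Ident_right[OF f] by simp
next
  fix f
  assume "f \<in> Arr (det C)"
  then have "f \<in> Arr C" by (simp add: det_def deterministic_def)
  then show "Dom (det C) f \<in> Obj (det C)" "Cod (det C) f \<in> Obj (det C)"
    using Dom_Obj Cod_Obj by simp_all
qed

context
  fixes P :: "'o \<Rightarrow> 'o" and samp :: "'o \<Rightarrow> 'm"
  assumes rep: "represented_by C P samp"
begin

lemma P_Obj: "X \<in> Obj C \<Longrightarrow> P X \<in> Obj C"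
  and samp_Hom: "X \<in> Obj C \<Longrightarrow> samp X \<in> Hom C (P X) X"
  using rep by (auto simp: represented_by_def distribution_object_def)

lemma sharp_ex1:
  assumes f: "f \<in> Hom C A X"
  shows "\<exists>!g. g \<in> Hom (det C) A (P X) \<and> samp X \<cdot> g = f"
proof -
  have "bij_betw (\<lambda>g. samp X \<cdot> g) (Hom (det C) A (P X)) (Hom C A X)"
    using rep Hom_Obj[OF f] by (auto simp: represented_by_def distribution_object_def)
  then have "inj_on (\<lambda>g. samp X \<cdot> g) (Hom (det C) A (P X))"
    and "f \<in> (\<lambda>g. samp X \<cdot> g) ` Hom (det C) A (P X)"
    using f by (simp_all add: bij_betw_def)
  then show ?thesis
    by (elim imageE) (rule ex1I, auto dest: inj_onD)
qed

lemma sharp_Hom: "f \<in> Hom C A X \<Longrightarrow> sharp C P samp f \<in> Hom (det C) A (P X)"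
  and samp_sharp: "f \<in> Hom C A X \<Longrightarrow> samp X \<cdot> sharp C P samp f = f"
proof -
  assume f: "f \<in> Hom C A X"
  then have "Dom C f = A" "Cod C f = X" by (auto simp: Hom_def)
  then have "sharp C P samp f \<in> Hom (det C) A (P X) \<and> samp X \<cdot> sharp C P samp f = f"
    unfolding sharp_def using theI'[OF sharp_ex1[OF f]] by simp
  then show "sharp C P samp f \<in> Hom (det C) A (P X)" "samp X \<cdot> sharp C P samp f = f"
    by auto
qed

lemma samp_cancel:
  assumes "g \<in> Hom (det C) A (P X)" "h \<in> Hom (det C) A (P X)" "X \<in> Obj C"
    and "samp X \<cdot> g = samp X \<cdot> h"
  shows "g = h"
proof -
  have "samp X \<cdot> g \<in> Hom C A X"
    using assms samp_Hom Comp_Hom by (auto simp: Hom_det)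
  then show ?thesis using sharp_ex1 assms by metis
qed

lemma dist_map_Hom: "f \<in> Hom C X Y \<Longrightarrow> dist_map C P samp f \<in> Hom (det C) (P X) (P Y)"
  and samp_dist_map: "f \<in> Hom C X Y \<Longrightarrow> samp Y \<cdot> dist_map C P samp f = f \<cdot> samp X"
proof -
  assume f: "f \<in> Hom C X Y"
  then have X: "X \<in> Obj C" "Dom C f = X" using Hom_Obj by (auto simp: Hom_def)
  have "f \<cdot> samp X \<in> Hom C (P X) Y" using Comp_Hom[OF samp_Hom[OF X(1)] f] .
  then show "dist_map C P samp f \<in> Hom (det C) (P X) (P Y)"
    "samp Y \<cdot> dist_map C P samp f = f \<cdot> samp X"
    using sharp_Hom samp_sharp X by (auto simp: dist_map_def)
qed

lemma det_Hom: "f \<in> Hom (det C) A B \<Longrightarrow> f \<in> Hom C A B"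
  by (simp add: Hom_det)

lemma dist_map_Ident:
  assumes X: "X \<in> Obj C" shows "dist_map C P samp (Ident C X) = Ident C (P X)"
proof (rule samp_cancel[OF dist_map_Hom[OF Ident_Hom[OF X]] _ X])
  interpret D: category "det C" by (rule category_det)
  show "Ident C (P X) \<in> Hom (det C) (P X) (P X)"
    using D.Ident_Hom[of "P X"] P_Obj[OF X] by simp
  show "samp X \<cdot> dist_map C P samp (Ident C X) = samp X \<cdot> Ident C (P X)"
    using samp_dist_map[OF Ident_Hom[OF X]] Ident_left Ident_right samp_Hom[OF X] by metis
qed

lemma dist_map_Comp:
  assumes f: "f \<in> Hom C X Y" and g: "g \<in> Hom C Y Z"
  shows "dist_map C P samp (g \<cdot> f) = dist_map C P samp g \<cdot> dist_map C P samp f"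
proof -
  note O = Hom_Obj[OF f] Hom_Obj[OF g]
  note Pf = dist_map_Hom[OF f] and Pg = dist_map_Hom[OF g]
  have "samp Z \<cdot> (dist_map C P samp g \<cdot> dist_map C P samp f)
      = (samp Z \<cdot> dist_map C P samp g) \<cdot> dist_map C P samp f"
    using Comp_assoc[OF det_Hom[OF Pf] det_Hom[OF Pg] samp_Hom[OF O(4)]] by simp
  also have "\<dots> = g \<cdot> (samp Y \<cdot> dist_map C P samp f)"
    using samp_dist_map[OF g] Comp_assoc[OF det_Hom[OF Pf] samp_Hom[OF O(2)] g] by simp
  also have "\<dots> = (g \<cdot> f) \<cdot> samp X"
    using samp_dist_map[OF f] Comp_assoc[OF samp_Hom[OF O(1)] f g] by simp
  also have "\<dots> = samp Z \<cdot> dist_map C P samp (g \<cdot> f)"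
    using samp_dist_map[OF Comp_Hom[OF f g]] by simp
  finally show ?thesis
    using samp_cancel[OF dist_map_Hom[OF Comp_Hom[OF f g]] det_Comp_Hom[OF Pf Pg] O(4)] by simp
qed

lemma monad_dist_monad: "monad (det C) (dist_monad C P samp)"
proof -
  interpret D: category "det C" by (rule category_det)
  have unit_nat: "sharp C P samp (Ident C Y) \<cdot> f = dist_map C P samp f \<cdot> sharp C P samp (Ident C X)"
    if f: "f \<in> Hom (det C) X Y" for f X Y
  proof -
    note f' = det_Hom[OF f]
    note O = Hom_Obj[OF f']
    note sX = sharp_Hom[OF Ident_Hom[OF O(1)]] and sY = sharp_Hom[OF Ident_Hom[OF O(2)]]
    note Pf = dist_map_Hom[OF f']
    have "samp Y \<cdot> (sharp C P samp (Ident C Y) \<cdot> f) = f"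
      using Comp_assoc[OF f' det_Hom[OF sY] samp_Hom[OF O(2)]] samp_sharp[OF Ident_Hom[OF O(2)]]
        Ident_left[OF f'] by simp
    moreover have "samp Y \<cdot> (dist_map C P samp f \<cdot> sharp C P samp (Ident C X)) = f"
      using Comp_assoc[OF det_Hom[OF sX] det_Hom[OF Pf] samp_Hom[OF O(2)]] samp_dist_map[OF f']
        Comp_assoc[OF det_Hom[OF sX] samp_Hom[OF O(1)] f'] samp_sharp[OF Ident_Hom[OF O(1)]]
        Ident_right[OF f'] by simp
    ultimately show ?thesis
      using samp_cancel[OF det_Comp_Hom[OF f sY] det_Comp_Hom[OF sX Pf] O(2)] by simp
  qed
  have mult_unit: "dist_map C P samp (samp X) \<cdot> sharp C P samp (Ident C (P X)) = Ident C (P X)"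
    if X: "X \<in> Obj C" for X
  proof -
    note PX = P_Obj[OF X] and s = samp_Hom[OF X]
    note d = sharp_Hom[OF Ident_Hom[OF PX]] and m = dist_map_Hom[OF s]
    have "samp X \<cdot> (dist_map C P samp (samp X) \<cdot> sharp C P samp (Ident C (P X))) = samp X \<cdot> Ident C (P X)"
      using Comp_assoc[OF det_Hom[OF d] det_Hom[OF m] s] samp_dist_map[OF s]
        Comp_assoc[OF det_Hom[OF d] samp_Hom[OF PX] s] samp_sharp[OF Ident_Hom[OF PX]] by simp
    then show ?thesis
      using samp_cancel[OF det_Comp_Hom[OF d m] _ X] D.Ident_Hom[of "P X"] PX by simp
  qed
  show ?thesis
  proof
    fix f X Y assume "f \<in> Hom (det C) X Y"
    note f = det_Hom[OF this]
    note O = Hom_Obj[OF f]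
    show "FunA (dist_monad C P samp) f \<in> Hom (det C) (FunO (dist_monad C P samp) X) (FunO (dist_monad C P samp) Y)"
      using dist_map_Hom[OF f] by (simp add: dist_monad_def)
    show "Mult (dist_monad C P samp) Y \<cdot>\<^bsub>det C\<^esub>
           FunA (dist_monad C P samp) (FunA (dist_monad C P samp) f) =
           FunA (dist_monad C P samp) f \<cdot>\<^bsub>det C\<^esub> Mult (dist_monad C P samp) X"
      using dist_map_Comp[OF det_Hom[OF dist_map_Hom[OF f]] samp_Hom[OF O(2)]]
        dist_map_Comp[OF samp_Hom[OF O(1)] f] samp_dist_map[OF f]
      by (simp add: dist_monad_def)
    show "Unit (dist_monad C P samp) Y \<cdot>\<^bsub>det C\<^esub> f =
           FunA (dist_monad C P samp) f \<cdot>\<^bsub>det C\<^esub> Unit (dist_monad C P samp) X"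
      using unit_nat[OF \<open>f \<in> Hom (det C) X Y\<close>] by (simp add: dist_monad_def)
  next
    fix f X Y g Z assume "f \<in> Hom (det C) X Y" "g \<in> Hom (det C) Y Z"
    then show "FunA (dist_monad C P samp) (g \<cdot>\<^bsub>det C\<^esub> f) =
           FunA (dist_monad C P samp) g \<cdot>\<^bsub>det C\<^esub> FunA (dist_monad C P samp) f"
      using dist_map_Comp[OF det_Hom det_Hom] by (simp add: dist_monad_def)
  next
    fix X assume "X \<in> Obj (det C)"
    then have X: "X \<in> Obj C" by simp
    note PX = P_Obj[OF X] and s = samp_Hom[OF X]
    note PPX = P_Obj[OF PX] and m = dist_map_Hom[OF s]
    show "FunO (dist_monad C P samp) X \<in> Obj (det C)"
      using PX by (simp add: dist_monad_def)
    show "FunA (dist_monad C P samp) (Ident (det C) X) = Ident (det C) (FunO (dist_monad C P samp) X)"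
      using dist_map_Ident[OF X] by (simp add: dist_monad_def)
    show "Mult (dist_monad C P samp) X \<in> Hom (det C)
           (FunO (dist_monad C P samp) (FunO (dist_monad C P samp) X)) (FunO (dist_monad C P samp) X)"
      using m by (simp add: dist_monad_def)
    show "Unit (dist_monad C P samp) X \<in> Hom (det C) X (FunO (dist_monad C P samp) X)"
      using sharp_Hom[OF Ident_Hom[OF X]] by (simp add: dist_monad_def)
    show "Mult (dist_monad C P samp) X \<cdot>\<^bsub>det C\<^esub> FunA (dist_monad C P samp) (Mult (dist_monad C P samp) X) =
           Mult (dist_monad C P samp) X \<cdot>\<^bsub>det C\<^esub> Mult (dist_monad C P samp) (FunO (dist_monad C P samp) X)"
      using dist_map_Comp[OF det_Hom[OF m] s] dist_map_Comp[OF samp_Hom[OF PX] s] samp_dist_map[OF s]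
      by (simp add: dist_monad_def)
    show "Mult (dist_monad C P samp) X \<cdot>\<^bsub>det C\<^esub> Unit (dist_monad C P samp) (FunO (dist_monad C P samp) X)
           = Ident (det C) (FunO (dist_monad C P samp) X)"
      using mult_unit[OF X] by (simp add: dist_monad_def)
    show "Mult (dist_monad C P samp) X \<cdot>\<^bsub>det C\<^esub> FunA (dist_monad C P samp) (Unit (dist_monad C P samp) X)
           = Ident (det C) (FunO (dist_monad C P samp) X)"
      using dist_map_Comp[OF det_Hom[OF sharp_Hom[OF Ident_Hom[OF X]]] s]
        samp_sharp[OF Ident_Hom[OF X]] dist_map_Ident[OF X]
      by (simp add: dist_monad_def)
  qed
qed

end

end

end

theory Submission
  imports Defs
begin

text \<open>
  Everything rests on the \<^emph>\<open>conditional product\<close>. Take \<open>q : S \<rightarrow> B\<close> and \<open>p : S \<rightarrow> B'\<close> with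
  \<open>m q = n p =: h\<close> for deterministic \<open>m : B \<rightarrow> D\<close> and \<open>n : B' \<rightarrow> D\<close>. Draw \<open>d\<close> from \<open>h\<close>, and then draw
  \<open>b\<close> and \<open>b'\<close> independently from the conditional distributions of \<open>q\<close> given \<open>m b = d\<close> and of \<open>p\<close>
  given \<open>n b' = d\<close>. The result is a joint distribution \<open>r : S \<rightarrow> B \<otimes> B'\<close> with marginals \<open>q\<close> and \<open>p\<close>
  for which \<open>m b = d = n b'\<close> holds almost surely (\<open>conditional_product\<close>). Two squares in
  the Markov category itself are then weak pullbacks.

  \<^item> Every weak pullback of deterministic maps is one for all maps
    (\<open>weak_pullback_det_imp_weak_pullback\<close>): by the equalizer principle \<open>r\<close> factors through the
    deterministic equalizer \<open>E\<close> of \<open>m \<pi>\<^sub>1\<close> and \<open>n \<pi>\<^sub>2\<close>, and \<open>E\<close> maps deterministically to the apex.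

  \<^item> The naturality square of the counit \<open>samp\<close> at a deterministic \<open>f : X \<rightarrow> Y\<close>
    (\<open>samp_square_weak_pullback\<close>): given \<open>q : S \<rightarrow> P Y\<close> and \<open>p : S \<rightarrow> X\<close> with
    \<open>samp q = f p\<close>, the conditional product couples the pair (distribution, sample from it) with \<open>p\<close>
    over the sample. The conditional \<open>c\<close> of the \<open>X\<close>-component given the \<open>P Y\<close>-component satisfies
    \<open>f c = samp \<pi>\<^sub>1\<close> almost surely, so \<open>P f c\<^sup>\<sharp> = \<pi>\<^sub>1\<close> almost surely by a.s.-compatibility, and
    \<open>c\<^sup>\<sharp>\<close> provides the lift \<open>S \<rightarrow> P X\<close>.

  The functor \<open>P\<close>, as a right adjoint of the inclusion of the deterministic maps, sends weak pullbacks
  to weak pullbacks of deterministic maps (\<open>dist_map_weak_pullback\<close>). Applied to the two squares this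
  gives the functor and the multiplication half of the claim, because the multiplication is
  \<open>P samp\<close>.

  The string diagrams are calculated with pairings \<open>\<langle>f, g\<rangle> = (f \<otimes> g) copy\<close> and the projections
  \<open>\<pi>\<^sub>1, \<pi>\<^sub>2\<close> obtained by discarding. By coassociativity and commutativity of copying, associators and
  swaps act on nested pairings as re-bracketing and exchange. Together with \<open>\<langle>\<pi>\<^sub>1, \<pi>\<^sub>2\<rangle> = id\<close> and the
  determinism of the projections this lets deterministic structure maps be computed as in a
  cartesian category, in front of an arbitrary morphism.
\<close>

section \<open>Composition by domain and codomain\<close>

lemma Arr_det [simp]: "Arr (det C) = {f. deterministic C f}"
  by (simp add: det_def)

lemma HomD:
  assumes "f \<in> Hom K A B"
  shows "f \<in> Arr K" "Dom K f = A" "Cod K f = B"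
  using assms by (auto simp: Hom_def)

context category
begin

text \<open>
  The laws below are phrased by equations between domains and codomains instead of hom-sets: as
  conditional rewrite rules they then have no variables that occur only in a condition, and the
  simplifier can normalize composites to the right.
\<close>

lemma Comp_typing [simp]:
  assumes "f \<in> Arr C" "g \<in> Arr C" "Cod C f = Dom C g"
  shows "g \<cdot> f \<in> Arr C" "Dom C (g \<cdot> f) = Dom C f" "Cod C (g \<cdot> f) = Cod C g"
  using Comp_Hom[of f "Dom C f" "Dom C g" g "Cod C g"] assms by (auto simp: Hom_def)

lemma Ident_typing [simp]:
  assumes "A \<in> Obj C"
  shows "Ident C A \<in> Arr C" "Dom C (Ident C A) = A" "Cod C (Ident C A) = A"
  using HomD[OF Ident_Hom[OF assms]] by auto

lemma Dom_Cod_Obj [simp]: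
  assumes "f \<in> Arr C"
  shows "Dom C f \<in> Obj C" "Cod C f \<in> Obj C"
  using assms Dom_Obj Cod_Obj by auto

lemma Cod_eq_Obj: "\<lbrakk>f \<in> Arr C; Cod C f = X\<rbrakk> \<Longrightarrow> X \<in> Obj C"
  using Cod_Obj by auto

lemma comp_assoc [simp]:
  assumes "f \<in> Arr C" "g \<in> Arr C" "h \<in> Arr C" "Cod C f = Dom C g" "Cod C g = Dom C h"
  shows "(h \<cdot> g) \<cdot> f = h \<cdot> (g \<cdot> f)"
  using assms Comp_assoc[of f "Dom C f" "Dom C g" g "Dom C h" h "Cod C h"] by (auto simp: Hom_def)

lemma comp_Ident [simp]:
  "\<lbrakk>f \<in> Arr C; Cod C f = B\<rbrakk> \<Longrightarrow> Ident C B \<cdot> f = f"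
  "\<lbrakk>f \<in> Arr C; Dom C f = A\<rbrakk> \<Longrightarrow> f \<cdot> Ident C A = f"
  using Ident_left Ident_right by (auto simp: Hom_def)

text \<open>Rewriting with \<open>g f = h\<close> inside a composite that is associated to the right.\<close>

lemma comp_assoc_rewrite:
  assumes "g \<cdot> f = h" "x \<in> Arr C" "f \<in> Arr C" "g \<in> Arr C" "Cod C x = Dom C f" "Cod C f = Dom C g"
  shows "g \<cdot> (f \<cdot> x) = h \<cdot> x"
  using comp_assoc[of x f g] assms by simp

lemma inverse_arrows_inv_arr:
  assumes "is_iso C f"
  shows "inverse_arrows C f (inv_arr C f)"
proof -
  obtain g where g: "inverse_arrows C f g" using assms by (auto simp: is_iso_def)
  have "h = g" if h: "inverse_arrows C f h" for h
  proof -
    have "h = h \<cdot> (f \<cdot> g)" using g h by (auto simp: inverse_arrows_def Hom_def)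
    also have "\<dots> = (h \<cdot> f) \<cdot> g"
      using g h by (intro comp_assoc[symmetric]) (auto simp: inverse_arrows_def Hom_def)
    also have "\<dots> = g" using g h by (auto simp: inverse_arrows_def Hom_def simp del: comp_assoc)
    finally show ?thesis .
  qed
  then show ?thesis unfolding inv_arr_def using g by (metis theI)
qed

lemma inv_arr_props:
  assumes "is_iso C f"
  shows "f \<in> Arr C" "inv_arr C f \<in> Arr C" "Dom C (inv_arr C f) = Cod C f" "Cod C (inv_arr C f) = Dom C f"
    "inv_arr C f \<cdot> f = Ident C (Dom C f)" "f \<cdot> inv_arr C f = Ident C (Cod C f)"
  using inverse_arrows_inv_arr[OF assms] by (auto simp: inverse_arrows_def Hom_def)

end

context markov_category
begin

section \<open>Pairing and projections\<close>

lemma Obj_typing [simp]: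
  "\<lbrakk>X \<in> Obj C; Y \<in> Obj C\<rbrakk> \<Longrightarrow> X \<otimes>\<^sub>o Y \<in> Obj C"
  "UnitO C \<in> Obj C"
  by (auto intro: TensO_Obj UnitO_Obj)

lemma TensA_typing [simp]:
  assumes "f \<in> Arr C" "g \<in> Arr C"
  shows "f \<otimes> g \<in> Arr C" "Dom C (f \<otimes> g) = Dom C f \<otimes>\<^sub>o Dom C g"
    "Cod C (f \<otimes> g) = Cod C f \<otimes>\<^sub>o Cod C g"
  using TensA_Hom[of f "Dom C f" "Cod C f" g "Dom C g" "Cod C g"] assms by (auto simp: Hom_def)

lemma Assoc_simps [simp]:
  assumes "X \<in> Obj C" "Y \<in> Obj C" "Z \<in> Obj C"
  shows
    "Assoc C X Y Z \<in> Arr C" "Dom C (Assoc C X Y Z) = (X \<otimes>\<^sub>o Y) \<otimes>\<^sub>o Z"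
    "Cod C (Assoc C X Y Z) = X \<otimes>\<^sub>o (Y \<otimes>\<^sub>o Z)"
    "inv_arr C (Assoc C X Y Z) \<in> Arr C" "Cod C (inv_arr C (Assoc C X Y Z)) = (X \<otimes>\<^sub>o Y) \<otimes>\<^sub>o Z"
    "Dom C (inv_arr C (Assoc C X Y Z)) = X \<otimes>\<^sub>o (Y \<otimes>\<^sub>o Z)"
    "inv_arr C (Assoc C X Y Z) \<cdot> Assoc C X Y Z = Ident C ((X \<otimes>\<^sub>o Y) \<otimes>\<^sub>o Z)"
    "Assoc C X Y Z \<cdot> inv_arr C (Assoc C X Y Z) = Ident C (X \<otimes>\<^sub>o (Y \<otimes>\<^sub>o Z))"
  using HomD[OF Assoc_Hom[OF assms]] inv_arr_props[OF Assoc_iso[OF assms]] by auto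

lemma Swap_Ident_simps [simp]:
  assumes "X \<in> Obj C" "Y \<in> Obj C"
  shows "Swap C X Y \<in> Arr C" "Dom C (Swap C X Y) = X \<otimes>\<^sub>o Y" "Cod C (Swap C X Y) = Y \<otimes>\<^sub>o X"
    "Swap C Y X \<cdot> Swap C X Y = Ident C (X \<otimes>\<^sub>o Y)"
    "Ident C X \<otimes> Ident C Y = Ident C (X \<otimes>\<^sub>o Y)"
  using HomD[OF Swap_Hom[OF assms]] Swap_Swap[OF assms] TensA_Ident[OF assms] by auto

lemma counit_structure_typing [simp]:
  assumes "X \<in> Obj C"
  shows
    "LUnit C X \<in> Arr C" "Dom C (LUnit C X) = UnitO C \<otimes>\<^sub>o X" "Cod C (LUnit C X) = X"
    "RUnit C X \<in> Arr C" "Dom C (RUnit C X) = X \<otimes>\<^sub>o UnitO C" "Cod C (RUnit C X) = X"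
    "Copy C X \<in> Arr C" "Dom C (Copy C X) = X" "Cod C (Copy C X) = X \<otimes>\<^sub>o X"
    "Del C X \<in> Arr C" "Dom C (Del C X) = X" "Cod C (Del C X) = UnitO C"
  using assms HomD[OF LUnit_Hom] HomD[OF RUnit_Hom] HomD[OF Copy_Hom] HomD[OF Del_Hom] by auto

lemma TensA_comp:
  assumes "f \<in> Arr C" "f' \<in> Arr C" "g \<in> Arr C" "g' \<in> Arr C" "Cod C f = Dom C f'" "Cod C g = Dom C g'"
  shows "(f' \<otimes> g') \<cdot> (f \<otimes> g) = (f' \<cdot> f) \<otimes> (g' \<cdot> g)"
  using TensA_Comp[of f "Dom C f" "Cod C f" f' "Cod C f'" g "Dom C g" "Cod C g" g' "Cod C g'"] assms
  by (auto simp: Hom_def)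

lemma TensA_comp_assoc:
  assumes "f \<in> Arr C" "f' \<in> Arr C" "g \<in> Arr C" "g' \<in> Arr C" "Cod C f = Dom C f'" "Cod C g = Dom C g'"
    "x \<in> Arr C" "Cod C x = Dom C f \<otimes>\<^sub>o Dom C g"
  shows "(f' \<otimes> g') \<cdot> ((f \<otimes> g) \<cdot> x) = ((f' \<cdot> f) \<otimes> (g' \<cdot> g)) \<cdot> x"
  using comp_assoc_rewrite[OF TensA_comp, of f f' g g' x] assms by simp

lemma Del_comp [simp]: "\<lbrakk>f \<in> Arr C; Cod C f = Y\<rbrakk> \<Longrightarrow> Del C Y \<cdot> f = Del C (Dom C f)"
  using Del_natural by (auto simp: Hom_def)

text \<open>
  Pairing is not a universal construction for morphisms that are not deterministic: a morphism
  into a tensor product is in general not the pairing of its two projections.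
\<close>

definition pair where "pair f g = (f \<otimes> g) \<cdot> Copy C (Dom C f)"
definition proj1 where "proj1 X Y = RUnit C X \<cdot> (Ident C X \<otimes> Del C Y)"
definition proj2 where "proj2 X Y = LUnit C Y \<cdot> (Del C X \<otimes> Ident C Y)"

lemma pair_typing [simp]:
  assumes "f \<in> Arr C" "g \<in> Arr C" "Dom C f = Dom C g"
  shows "pair f g \<in> Arr C" "Dom C (pair f g) = Dom C g" "Cod C (pair f g) = Cod C f \<otimes>\<^sub>o Cod C g"
  using assms by (auto simp: pair_def)

lemma proj_typing [simp]:
  assumes "X \<in> Obj C" "Y \<in> Obj C"
  shows "proj1 X Y \<in> Arr C" "Dom C (proj1 X Y) = X \<otimes>\<^sub>o Y" "Cod C (proj1 X Y) = X"
    "proj2 X Y \<in> Arr C" "Dom C (proj2 X Y) = X \<otimes>\<^sub>o Y" "Cod C (proj2 X Y) = Y"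
  using assms by (auto simp: proj1_def proj2_def)

lemma TensA_pair [simp]:
  assumes "f \<in> Arr C" "f' \<in> Arr C" "g \<in> Arr C" "g' \<in> Arr C" "Cod C f = Dom C f'" "Cod C g = Dom C g'"
    "Dom C f = Dom C g"
  shows "(f' \<otimes> g') \<cdot> pair f g = pair (f' \<cdot> f) (g' \<cdot> g)"
  using assms TensA_comp_assoc[of f f' g g' "Copy C (Dom C f)"] by (simp add: pair_def)

lemma Assoc_pair [simp]:
  assumes "f \<in> Arr C" "g \<in> Arr C" "h \<in> Arr C" "Dom C f = Dom C g" "Dom C g = Dom C h"
    "Cod C f = X" "Cod C g = Y" "Cod C h = Z"
  shows "Assoc C X Y Z \<cdot> pair (pair f g) h = pair f (pair g h)"
proof -
  let ?A = "Dom C h"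
  note [simp] = Cod_eq_Obj[OF assms(1,6)] Cod_eq_Obj[OF assms(2,7)] Cod_eq_Obj[OF assms(3,8)]
  have "Assoc C X Y Z \<cdot> pair (pair f g) h
      = Assoc C X Y Z \<cdot> (((f \<otimes> g) \<otimes> h) \<cdot> ((Copy C ?A \<otimes> Ident C ?A) \<cdot> Copy C ?A))"
    using assms by (simp add: pair_def TensA_comp_assoc)
  also have "\<dots> = (f \<otimes> (g \<otimes> h)) \<cdot> (Assoc C ?A ?A ?A \<cdot> ((Copy C ?A \<otimes> Ident C ?A) \<cdot> Copy C ?A))"
    using assms comp_assoc_rewrite[OF Assoc_natural[of f ?A X g ?A Y h ?A Z],
        of "(Copy C ?A \<otimes> Ident C ?A) \<cdot> Copy C ?A"]
    by (simp add: Hom_def)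
  also have "\<dots> = pair f (pair g h)"
    using assms by (simp add: Copy_coassoc pair_def TensA_comp_assoc)
  finally show ?thesis .
qed

lemma inv_Assoc_pair [simp]:
  assumes "f \<in> Arr C" "g \<in> Arr C" "h \<in> Arr C" "Dom C f = Dom C g" "Dom C g = Dom C h"
    "Cod C f = X" "Cod C g = Y" "Cod C h = Z"
  shows "inv_arr C (Assoc C X Y Z) \<cdot> pair f (pair g h) = pair (pair f g) h"
proof -
  have "inv_arr C (Assoc C X Y Z) \<cdot> pair f (pair g h)
      = inv_arr C (Assoc C X Y Z) \<cdot> (Assoc C X Y Z \<cdot> pair (pair f g) h)"
    using assms by simp
  also have "\<dots> = (inv_arr C (Assoc C X Y Z) \<cdot> Assoc C X Y Z) \<cdot> pair (pair f g) h"
    using assms by (subst comp_assoc) auto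
  also have "\<dots> = pair (pair f g) h"
    by (subst Assoc_simps(7)) (use assms in auto)
  finally show ?thesis .
qed

lemma Swap_pair [simp]:
  assumes "f \<in> Arr C" "g \<in> Arr C" "Dom C f = Dom C g" "Cod C f = X" "Cod C g = Y"
  shows "Swap C X Y \<cdot> pair f g = pair g f"
  using assms Cod_eq_Obj[OF assms(1,4)] Cod_eq_Obj[OF assms(2,5)]
    comp_assoc_rewrite[OF Swap_natural[of f "Dom C f" X g "Dom C g" Y], of "Copy C (Dom C f)"]
  by (simp add: Hom_def pair_def Copy_commutative)

lemma proj_pair [simp]:
  assumes "f \<in> Arr C" "g \<in> Arr C" "Dom C f = Dom C g" "Cod C f = X" "Cod C g = Y"
  shows "proj1 X Y \<cdot> pair f g = f" "proj2 X Y \<cdot> pair f g = g"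
proof -
  let ?A = "Dom C g"
  note [simp] = Cod_eq_Obj[OF assms(1,4)] Cod_eq_Obj[OF assms(2,5)]
  have "proj1 X Y \<cdot> pair f g = RUnit C X \<cdot> ((f \<otimes> Ident C (UnitO C)) \<cdot> ((Ident C ?A \<otimes> Del C ?A) \<cdot> Copy C ?A))"
    using assms by (simp add: proj1_def pair_def TensA_comp_assoc)
  also have "\<dots> = f \<cdot> (RUnit C ?A \<cdot> ((Ident C ?A \<otimes> Del C ?A) \<cdot> Copy C ?A))"
    using assms comp_assoc_rewrite[OF RUnit_natural[of f ?A X], of "(Ident C ?A \<otimes> Del C ?A) \<cdot> Copy C ?A"]
    by (simp add: Hom_def)
  also have "\<dots> = f" using assms by (simp add: Copy_counit_right)
  finally show "proj1 X Y \<cdot> pair f g = f" .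
  have "proj2 X Y \<cdot> pair f g = LUnit C Y \<cdot> ((Ident C (UnitO C) \<otimes> g) \<cdot> ((Del C ?A \<otimes> Ident C ?A) \<cdot> Copy C ?A))"
    using assms by (simp add: proj2_def pair_def TensA_comp_assoc)
  also have "\<dots> = g \<cdot> (LUnit C ?A \<cdot> ((Del C ?A \<otimes> Ident C ?A) \<cdot> Copy C ?A))"
    using assms comp_assoc_rewrite[OF LUnit_natural[of g ?A Y], of "(Del C ?A \<otimes> Ident C ?A) \<cdot> Copy C ?A"]
    by (simp add: Hom_def)
  also have "\<dots> = g" using assms by (simp add: Copy_counit_left)
  finally show "proj2 X Y \<cdot> pair f g = g" .
qed

lemma Copy_eq_pair: "X \<in> Obj C \<Longrightarrow> Copy C X = pair (Ident C X) (Ident C X)"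
  by (simp add: pair_def)

text \<open>The unit object is terminal, and so is its isomorphic copy \<open>I \<otimes> I\<close>, which therefore has a
  single endomorphism.\<close>

lemma Swap_UnitO: "Swap C (UnitO C) (UnitO C) = Ident C (UnitO C \<otimes>\<^sub>o UnitO C)"
proof -
  let ?I = "UnitO C" and ?l = "LUnit C (UnitO C)"
  note l = inv_arr_props[OF LUnit_iso[of ?I]]
  have "?l \<cdot> Swap C ?I ?I = ?l"
    using Del_comp[of "?l \<cdot> Swap C ?I ?I" ?I] Del_comp[of ?l ?I] by (simp add: Del_UnitO)
  then have "inv_arr C ?l \<cdot> (?l \<cdot> Swap C ?I ?I) = inv_arr C ?l \<cdot> ?l" by simp
  moreover have "inv_arr C ?l \<cdot> (?l \<cdot> Swap C ?I ?I) = Swap C ?I ?I"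
    using l by (subst comp_assoc_rewrite[OF l(5)]) auto
  ultimately show ?thesis using l by simp
qed

lemma Interchange_typing [simp]:
  assumes "X \<in> Obj C" "X' \<in> Obj C" "Y \<in> Obj C" "Y' \<in> Obj C"
  shows "Interchange C X X' Y Y' \<in> Arr C"
    "Dom C (Interchange C X X' Y Y') = (X \<otimes>\<^sub>o X') \<otimes>\<^sub>o (Y \<otimes>\<^sub>o Y')"
    "Cod C (Interchange C X X' Y Y') = (X \<otimes>\<^sub>o Y) \<otimes>\<^sub>o (X' \<otimes>\<^sub>o Y')"
  using assms by (auto simp: Interchange_def)


section \<open>The projections are deterministic and jointly the identity\<close>

lemma Interchange_pair:
  assumes "a \<in> Arr C" "b \<in> Arr C" "c \<in> Arr C" "d \<in> Arr C"
    "Dom C a = Dom C d" "Dom C b = Dom C d" "Dom C c = Dom C d"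
    "Cod C a = X" "Cod C b = X'" "Cod C c = Y" "Cod C d = Y'"
  shows "Interchange C X X' Y Y' \<cdot> pair (pair a b) (pair c d) = pair (pair a c) (pair b d)"
proof -
  note [simp] = Cod_eq_Obj[OF assms(1,8)] Cod_eq_Obj[OF assms(2,9)]
    Cod_eq_Obj[OF assms(3,10)] Cod_eq_Obj[OF assms(4,11)]
  show ?thesis
    using assms by (simp add: Interchange_def)
qed

lemma Assoc_nat:
  assumes "f \<in> Arr C" "g \<in> Arr C" "h \<in> Arr C"
  shows "Assoc C (Cod C f) (Cod C g) (Cod C h) \<cdot> ((f \<otimes> g) \<otimes> h)
    = (f \<otimes> (g \<otimes> h)) \<cdot> Assoc C (Dom C f) (Dom C g) (Dom C h)"
  using Assoc_natural assms by (auto simp: Hom_def)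

lemma inv_Assoc_nat:
  assumes "f \<in> Arr C" "g \<in> Arr C" "h \<in> Arr C"
  shows "inv_arr C (Assoc C (Cod C f) (Cod C g) (Cod C h)) \<cdot> (f \<otimes> (g \<otimes> h))
    = ((f \<otimes> g) \<otimes> h) \<cdot> inv_arr C (Assoc C (Dom C f) (Dom C g) (Dom C h))"
proof -
  let ?a = "Assoc C (Dom C f) (Dom C g) (Dom C h)" and ?b = "Assoc C (Cod C f) (Cod C g) (Cod C h)"
  have "inv_arr C ?b \<cdot> (f \<otimes> (g \<otimes> h)) = inv_arr C ?b \<cdot> (((f \<otimes> (g \<otimes> h)) \<cdot> ?a) \<cdot> inv_arr C ?a)"
    using assms by simp
  also have "\<dots> = inv_arr C ?b \<cdot> (?b \<cdot> (((f \<otimes> g) \<otimes> h) \<cdot> inv_arr C ?a))"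
    using assms by (subst Assoc_nat[symmetric]) simp_all
  also have "\<dots> = ((f \<otimes> g) \<otimes> h) \<cdot> inv_arr C ?a"
    using assms by (subst comp_assoc_rewrite[OF Assoc_simps(7)]) simp_all
  finally show ?thesis .
qed

text \<open>The middle factor of the interchange isomorphism, \<open>X \<otimes> (Y \<otimes> Z) \<rightarrow> Y \<otimes> (X \<otimes> Z)\<close>.\<close>

definition Exchange where
  "Exchange X Y Z = Assoc C Y X Z \<cdot> (Swap C X Y \<otimes> Ident C Z) \<cdot> inv_arr C (Assoc C X Y Z)"

lemma Exchange_typing [simp]:
  assumes "X \<in> Obj C" "Y \<in> Obj C" "Z \<in> Obj C"
  shows "Exchange X Y Z \<in> Arr C" "Dom C (Exchange X Y Z) = X \<otimes>\<^sub>o (Y \<otimes>\<^sub>o Z)"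
    "Cod C (Exchange X Y Z) = Y \<otimes>\<^sub>o (X \<otimes>\<^sub>o Z)"
  using assms by (auto simp: Exchange_def)

lemma Exchange_natural:
  assumes "f \<in> Arr C" "g \<in> Arr C" "h \<in> Arr C"
  shows "Exchange (Cod C f) (Cod C g) (Cod C h) \<cdot> (f \<otimes> (g \<otimes> h))
    = (g \<otimes> (f \<otimes> h)) \<cdot> Exchange (Dom C f) (Dom C g) (Dom C h)"
proof -
  have s: "Swap C (Cod C f) (Cod C g) \<cdot> (f \<otimes> g) = (g \<otimes> f) \<cdot> Swap C (Dom C f) (Dom C g)"
    using Swap_natural assms by (auto simp: Hom_def)
  let ?i = "inv_arr C (Assoc C (Dom C f) (Dom C g) (Dom C h))"
  have "Exchange (Cod C f) (Cod C g) (Cod C h) \<cdot> (f \<otimes> (g \<otimes> h))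
      = Assoc C (Cod C g) (Cod C f) (Cod C h)
        \<cdot> ((Swap C (Cod C f) (Cod C g) \<otimes> Ident C (Cod C h)) \<cdot> (((f \<otimes> g) \<otimes> h) \<cdot> ?i))"
    using assms by (simp add: Exchange_def inv_Assoc_nat)
  also have "\<dots> = Assoc C (Cod C g) (Cod C f) (Cod C h)
        \<cdot> (((g \<otimes> f) \<otimes> h) \<cdot> ((Swap C (Dom C f) (Dom C g) \<otimes> Ident C (Dom C h)) \<cdot> ?i))"
    using assms by (simp add: TensA_comp_assoc s)
  also have "\<dots> = (g \<otimes> (f \<otimes> h)) \<cdot> Exchange (Dom C f) (Dom C g) (Dom C h)"
    using assms by (simp add: Exchange_def comp_assoc_rewrite[OF Assoc_nat])
  finally show ?thesis .
qed

lemma Exchange_inverse: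
  assumes "X \<in> Obj C" "Y \<in> Obj C" "Z \<in> Obj C"
  shows "Exchange Y X Z \<cdot> Exchange X Y Z = Ident C (X \<otimes>\<^sub>o (Y \<otimes>\<^sub>o Z))"
  using assms
  by (simp add: Exchange_def comp_assoc_rewrite[OF Assoc_simps(7)] TensA_comp_assoc)

lemma Interchange_Exchange:
  "Interchange C X X' Y Y' = inv_arr C (Assoc C X Y (X' \<otimes>\<^sub>o Y'))
     \<cdot> (Ident C X \<otimes> Exchange X' Y Y') \<cdot> Assoc C X X' (Y \<otimes>\<^sub>o Y')"
  by (simp add: Interchange_def Exchange_def)

lemma Interchange_natural:
  assumes "a \<in> Arr C" "b \<in> Arr C" "c \<in> Arr C" "d \<in> Arr C"
  shows "((a \<otimes> c) \<otimes> (b \<otimes> d)) \<cdot> Interchange C (Dom C a) (Dom C b) (Dom C c) (Dom C d)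
    = Interchange C (Cod C a) (Cod C b) (Cod C c) (Cod C d) \<cdot> ((a \<otimes> b) \<otimes> (c \<otimes> d))"
proof -
  let ?r = "Assoc C (Dom C a) (Dom C b) (Dom C c \<otimes>\<^sub>o Dom C d)"
  let ?i = "inv_arr C (Assoc C (Cod C a) (Cod C c) (Cod C b \<otimes>\<^sub>o Cod C d))"
  have "Interchange C (Cod C a) (Cod C b) (Cod C c) (Cod C d) \<cdot> ((a \<otimes> b) \<otimes> (c \<otimes> d))
     = ?i \<cdot> ((Ident C (Cod C a) \<otimes> Exchange (Cod C b) (Cod C c) (Cod C d)) \<cdot> ((a \<otimes> (b \<otimes> (c \<otimes> d))) \<cdot> ?r))"
    using assms Assoc_nat[of a b "c \<otimes> d"] by (simp add: Interchange_Exchange)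
  also have "\<dots> = ?i \<cdot> ((a \<otimes> (c \<otimes> (b \<otimes> d)))
      \<cdot> ((Ident C (Dom C a) \<otimes> Exchange (Dom C b) (Dom C c) (Dom C d)) \<cdot> ?r))"
    using assms by (simp add: TensA_comp_assoc Exchange_natural)
  also have "\<dots> = ((a \<otimes> c) \<otimes> (b \<otimes> d)) \<cdot> Interchange C (Dom C a) (Dom C b) (Dom C c) (Dom C d)"
    using assms comp_assoc_rewrite[OF inv_Assoc_nat[of a c "b \<otimes> d"],
        of "(Ident C (Dom C a) \<otimes> Exchange (Dom C b) (Dom C c) (Dom C d)) \<cdot> ?r"]
    by (simp add: Interchange_Exchange)
  finally show ?thesis by simp
qed

lemma Interchange_UnitO:
  assumes "X \<in> Obj C" "Y \<in> Obj C"
  shows "Interchange C X (UnitO C) (UnitO C) Y = Ident C ((X \<otimes>\<^sub>o UnitO C) \<otimes>\<^sub>o (UnitO C \<otimes>\<^sub>o Y))"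
  using assms by (simp add: Interchange_def Swap_UnitO)

lemma Interchange_inverse:
  assumes "X \<in> Obj C" "X' \<in> Obj C" "Y \<in> Obj C" "Y' \<in> Obj C"
  shows "Interchange C X Y X' Y' \<cdot> Interchange C X X' Y Y' = Ident C ((X \<otimes>\<^sub>o X') \<otimes>\<^sub>o (Y \<otimes>\<^sub>o Y'))"
  using assms
  by (simp add: Interchange_Exchange comp_assoc_rewrite[OF Assoc_simps(8)] TensA_comp_assoc
      Exchange_inverse)

text \<open>
  Copying \<open>X \<otimes> Y\<close> is copying both factors and interchanging. The two discarded copies
  are moved before the interchange by naturality, where they turn the swap \<open>X \<otimes> Y \<rightarrow> Y \<otimes> X\<close> inside
  it into the swap of \<open>I \<otimes> I\<close>, an identity; the counit laws do the rest.
\<close>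

lemma pair_proj [simp]:
  assumes [simp]: "X \<in> Obj C" "Y \<in> Obj C"
  shows "pair (proj1 X Y) (proj2 X Y) = Ident C (X \<otimes>\<^sub>o Y)"
proof -
  let ?I = "UnitO C"
  let ?J = "Ident C X \<otimes> Del C Y" and ?K = "Del C X \<otimes> Ident C Y"
  let ?c = "Copy C X \<otimes> Copy C Y"
  have "pair (proj1 X Y) (proj2 X Y)
      = (RUnit C X \<otimes> LUnit C Y) \<cdot> ((?J \<otimes> ?K) \<cdot> (Interchange C X X Y Y \<cdot> ?c))"
    by (simp add: pair_def proj1_def proj2_def Copy_TensO TensA_comp_assoc)
  also have "(?J \<otimes> ?K) \<cdot> (Interchange C X X Y Y \<cdot> ?c)
      = Interchange C X ?I ?I Y \<cdot> (((Ident C X \<otimes> Del C X) \<otimes> (Del C Y \<otimes> Ident C Y)) \<cdot> ?c)"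
    using comp_assoc_rewrite[OF Interchange_natural[of "Ident C X" "Del C X" "Del C Y" "Ident C Y"], of ?c]
    by simp
  also have "(RUnit C X \<otimes> LUnit C Y) \<cdot> \<dots>
      = (RUnit C X \<cdot> ((Ident C X \<otimes> Del C X) \<cdot> Copy C X)) \<otimes> (LUnit C Y \<cdot> ((Del C Y \<otimes> Ident C Y) \<cdot> Copy C Y))"
    by (simp add: Interchange_UnitO TensA_comp)
  also have "\<dots> = Ident C (X \<otimes>\<^sub>o Y)"
    by (simp add: Copy_counit_left Copy_counit_right)
  finally show ?thesis .
qed

lemma deterministicI:
  "\<lbrakk>f \<in> Arr C; Copy C (Cod C f) \<cdot> f = pair f f\<rbrakk> \<Longrightarrow> deterministic C f"
  by (simp add: deterministic_def pair_def)

lemma Copy_det: "deterministic C f \<Longrightarrow> Cod C f = X \<Longrightarrow> Copy C X \<cdot> f = pair f f"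
  by (auto simp: deterministic_def pair_def)

text \<open>
  Interchanging \<open>\<langle>\<langle>\<pi>\<^sub>1, \<pi>\<^sub>1\<rangle>, \<langle>\<pi>\<^sub>2, \<pi>\<^sub>2\<rangle>\<rangle>\<close> gives \<open>\<langle>id, id\<rangle> = copy\<close>, which is also the interchange of
  \<open>copy \<otimes> copy = \<langle>copy \<pi>\<^sub>1, copy \<pi>\<^sub>2\<rangle>\<close>. The interchange is invertible, so the components agree.
\<close>

lemma deterministic_proj [simp]:
  assumes [simp]: "X \<in> Obj C" "Y \<in> Obj C"
  shows "deterministic C (proj1 X Y)" "deterministic C (proj2 X Y)"
proof -
  let ?p = "proj1 X Y" and ?q = "proj2 X Y" and ?Z = "X \<otimes>\<^sub>o Y"
  have "Interchange C X X Y Y \<cdot> pair (pair ?p ?p) (pair ?q ?q) = Copy C ?Z"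
    by (simp add: Interchange_pair Copy_eq_pair)
  also have "\<dots> = Interchange C X X Y Y \<cdot> ((Copy C X \<otimes> Copy C Y) \<cdot> pair ?p ?q)"
    by (simp add: Copy_TensO del: TensA_pair)
  finally have "Interchange C X X Y Y \<cdot> pair (pair ?p ?p) (pair ?q ?q)
      = Interchange C X X Y Y \<cdot> pair (Copy C X \<cdot> ?p) (Copy C Y \<cdot> ?q)"
    by (simp del: pair_proj)
  then have "Interchange C X Y X Y \<cdot> (Interchange C X X Y Y \<cdot> pair (pair ?p ?p) (pair ?q ?q))
      = Interchange C X Y X Y \<cdot> (Interchange C X X Y Y \<cdot> pair (Copy C X \<cdot> ?p) (Copy C Y \<cdot> ?q))"
    by (rule arg_cong)
  then have *: "pair (pair ?p ?p) (pair ?q ?q) = pair (Copy C X \<cdot> ?p) (Copy C Y \<cdot> ?q)"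
    by (simp add: comp_assoc_rewrite[OF Interchange_inverse])
  from arg_cong[OF *, of "\<lambda>u. proj1 (X \<otimes>\<^sub>o X) (Y \<otimes>\<^sub>o Y) \<cdot> u"] show "deterministic C ?p"
    by (intro deterministicI) auto
  from arg_cong[OF *, of "\<lambda>u. proj2 (X \<otimes>\<^sub>o X) (Y \<otimes>\<^sub>o Y) \<cdot> u"] show "deterministic C ?q"
    by (intro deterministicI) auto
qed


section \<open>Pairing calculus\<close>

lemma deterministic_Arr: "deterministic C f \<Longrightarrow> f \<in> Arr C"
  by (simp add: deterministic_def)

lemma det_HomD:
  assumes "f \<in> Hom (det C) A B"
  shows "f \<in> Hom C A B" "deterministic C f"
  using assms by (auto simp: Hom_def det_def deterministic_def)

lemma det_HomI: "\<lbrakk>deterministic C f; f \<in> Hom C A B\<rbrakk> \<Longrightarrow> f \<in> Hom (det C) A B"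
  by (auto simp: Hom_def det_def deterministic_def)

lemma pair_det [simp]:
  assumes "deterministic C d" "f \<in> Arr C" "g \<in> Arr C" "Dom C f = Cod C d" "Dom C g = Cod C d"
  shows "pair f g \<cdot> d = pair (f \<cdot> d) (g \<cdot> d)"
proof -
  note [simp] = deterministic_Arr[OF assms(1)]
  have "pair f g \<cdot> d = (f \<otimes> g) \<cdot> (Copy C (Cod C d) \<cdot> d)"
    using assms(2-) by (simp add: pair_def)
  also have "\<dots> = pair (f \<cdot> d) (g \<cdot> d)"
    using assms by (simp add: Copy_det)
  finally show ?thesis .
qed

lemma pair_reassoc [simp]:
  assumes "f \<in> Arr C" "g \<in> Arr C" "x \<in> Arr C" "Dom C f = Cod C x" "Dom C g = Cod C x"
  shows
    "f' \<in> Arr C \<Longrightarrow> g' \<in> Arr C \<Longrightarrow> Cod C f = Dom C f' \<Longrightarrow> Cod C g = Dom C g'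
      \<Longrightarrow> (f' \<otimes> g') \<cdot> (pair f g \<cdot> x) = pair (f' \<cdot> f) (g' \<cdot> g) \<cdot> x"
    "Cod C f = X \<Longrightarrow> Cod C g = Y \<Longrightarrow> Swap C X Y \<cdot> (pair f g \<cdot> x) = pair g f \<cdot> x"
    "Cod C f = X \<Longrightarrow> Cod C g = Y \<Longrightarrow> proj1 X Y \<cdot> (pair f g \<cdot> x) = f \<cdot> x"
    "Cod C f = X \<Longrightarrow> Cod C g = Y \<Longrightarrow> proj2 X Y \<cdot> (pair f g \<cdot> x) = g \<cdot> x"
    "h \<in> Arr C \<Longrightarrow> Dom C h = Cod C x \<Longrightarrow> Cod C f = X \<Longrightarrow> Cod C g = Y \<Longrightarrow> Cod C h = Z
      \<Longrightarrow> Assoc C X Y Z \<cdot> (pair (pair f g) h \<cdot> x) = pair f (pair g h) \<cdot> x"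
    "h \<in> Arr C \<Longrightarrow> Dom C h = Cod C x \<Longrightarrow> Cod C f = X \<Longrightarrow> Cod C g = Y \<Longrightarrow> Cod C h = Z
      \<Longrightarrow> inv_arr C (Assoc C X Y Z) \<cdot> (pair f (pair g h) \<cdot> x) = pair (pair f g) h \<cdot> x"
  subgoal using assms by (subst comp_assoc_rewrite[OF TensA_pair]) auto
  subgoal using assms by (subst comp_assoc_rewrite[OF Swap_pair]) auto
  subgoal using assms by (subst comp_assoc_rewrite[OF proj_pair(1)]) auto
  subgoal using assms by (subst comp_assoc_rewrite[OF proj_pair(2)]) auto
  subgoal using assms by (subst comp_assoc_rewrite[OF Assoc_pair]) auto
  subgoal using assms by (subst comp_assoc_rewrite[OF inv_Assoc_pair]) auto
  done

lemma deterministic_comp [simp]: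
  assumes "deterministic C f" "deterministic C g" "Cod C f = Dom C g"
  shows "deterministic C (g \<cdot> f)"
  using det_Comp_Hom[of f "Dom C f" "Cod C f" g "Cod C g"] assms
  by (auto simp: deterministic_def Hom_def det_def)

text \<open>
  The defining equation of a conditional in pairing form. The string diagram shares the
  \<open>X\<close>-wire between the output and the input of \<open>c\<close>; on \<open>X \<otimes> A\<close> this sharing is
  \<open>\<langle>\<pi>\<^sub>1, id\<rangle>\<close>.
\<close>

lemma conditional_pair:
  assumes "is_conditional C A X Y f c" "A \<in> Obj C" "X \<in> Obj C" "Y \<in> Obj C" "f \<in> Hom C A (X \<otimes>\<^sub>o Y)"
  shows "c \<in> Hom C (X \<otimes>\<^sub>o A) Y"
    "f = pair (proj1 X A) c \<cdot> pair (proj1 X Y \<cdot> f) (Ident C A)"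
proof -
  show c: "c \<in> Hom C (X \<otimes>\<^sub>o A) Y" using assms(1) by (simp add: is_conditional_def)
  note [simp] = assms(2-4) HomD[OF assms(5)] HomD[OF c]
  have m: "marginal1 C X Y f = proj1 X Y \<cdot> f"
    by (simp add: marginal1_def proj1_def)
  have "Assoc C X X A \<cdot> (Copy C X \<otimes> Ident C A) = pair (proj1 X A) (Ident C (X \<otimes>\<^sub>o A))"
  proof -
    have "Assoc C X X A \<cdot> (Copy C X \<otimes> Ident C A)
       = Assoc C X X A \<cdot> ((Copy C X \<otimes> Ident C A) \<cdot> pair (proj1 X A) (proj2 X A))"
      by (simp del: TensA_pair)
    also have "\<dots> = pair (proj1 X A) (Ident C (X \<otimes>\<^sub>o A))"
      by (simp add: Copy_eq_pair del: pair_proj) simp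
    finally show ?thesis .
  qed
  note r = comp_assoc_rewrite[OF this]
  have "f = (Ident C X \<otimes> c) \<cdot> (Assoc C X X A \<cdot> ((Copy C X \<otimes> Ident C A) \<cdot>
      ((marginal1 C X Y f \<otimes> Ident C A) \<cdot> Copy C A)))"
    using assms(1) by (simp add: is_conditional_def)
  also have "\<dots> = (Ident C X \<otimes> c) \<cdot> (pair (proj1 X A) (Ident C (X \<otimes>\<^sub>o A))
      \<cdot> pair (proj1 X Y \<cdot> f) (Ident C A))"
    by (subst r) (simp_all add: m pair_def)
  also have "\<dots> = pair (proj1 X A) c \<cdot> pair (proj1 X Y \<cdot> f) (Ident C A)"
    by simp
  finally show "f = pair (proj1 X A) c \<cdot> pair (proj1 X Y \<cdot> f) (Ident C A)" .
qed

lemma as_eq_pair: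
  assumes "p \<in> Hom C A X" "f \<in> Hom C X Y" "g \<in> Hom C X Y"
  shows "as_eq C X p f g \<longleftrightarrow> pair (Ident C X) f \<cdot> p = pair (Ident C X) g \<cdot> p"
proof -
  note [simp] = HomD[OF assms(1)] HomD[OF assms(2)] HomD[OF assms(3)] Hom_Obj[OF assms(1)]
  show ?thesis by (simp add: as_eq_def pair_def)
qed


section \<open>Almost sure equality along a graph\<close>

lemma pair_rotate:
  assumes "pair (pair a b) c \<cdot> x = pair (pair a' b') c' \<cdot> x'"
    and "a \<in> Hom C A X" "b \<in> Hom C A Y" "c \<in> Hom C A Z" "x \<in> Hom C S A"
    and "a' \<in> Hom C A' X" "b' \<in> Hom C A' Y" "c' \<in> Hom C A' Z" "x' \<in> Hom C S A'"
  shows "pair (pair a c) b \<cdot> x = pair (pair a' c') b' \<cdot> x'"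
proof -
  note [simp] = assms(2-)[THEN HomD(1)] assms(2-)[THEN HomD(2)] assms(2-)[THEN HomD(3)]
    assms(2-)[THEN Hom_Obj(1)] assms(2-)[THEN Hom_Obj(2)]
  show ?thesis
    using arg_cong[OF assms(1), of "\<lambda>u. inv_arr C (Assoc C X Z Y) \<cdot> ((Ident C X \<otimes> Swap C Y Z)
      \<cdot> (Assoc C X Y Z \<cdot> u))"] by simp
qed

text \<open>
  The second component of \<open>\<langle>h, id\<rangle>\<close> is a copy of the input \<open>S\<close>, so recording it after
  \<open>\<langle>h, id\<rangle>\<close> is the same as recording the input beforehand.
\<close>

lemma pair_proj2_graph:
  assumes "h \<in> Hom C S D" "w \<in> Hom C (D \<otimes>\<^sub>o S) W"
  shows "pair w (proj2 D S) \<cdot> pair h (Ident C S) = pair (w \<cdot> pair h (Ident C S)) (Ident C S)"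
proof -
  note [simp] = assms[THEN HomD(1)] assms[THEN HomD(2)] assms[THEN HomD(3)]
    Hom_Obj[OF assms(1)] Hom_Obj[OF assms(2)]
  let ?k = "pair h (Ident C S)"
  have "(Ident C D \<otimes> Copy C S) \<cdot> pair (proj1 D S) (proj2 D S)
      = pair (proj1 D S) (pair (proj2 D S) (proj2 D S))"
    by (simp add: Copy_eq_pair del: pair_proj)
  then have c: "Ident C D \<otimes> Copy C S = pair (proj1 D S) (pair (proj2 D S) (proj2 D S))"
    by (simp del: TensA_pair)
  have "pair (Ident C (D \<otimes>\<^sub>o S)) (proj2 D S)
      = inv_arr C (Assoc C D S S) \<cdot> (Ident C D \<otimes> Copy C S)"
    by (simp add: c)
  then have "pair (Ident C (D \<otimes>\<^sub>o S)) (proj2 D S) \<cdot> ?k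
      = inv_arr C (Assoc C D S S) \<cdot> ((Ident C D \<otimes> Copy C S) \<cdot> ?k)"
    by simp
  also have "\<dots> = pair ?k (Ident C S)"
    by (simp add: Copy_eq_pair)
  finally have "(w \<otimes> Ident C S) \<cdot> (pair (Ident C (D \<otimes>\<^sub>o S)) (proj2 D S) \<cdot> ?k)
      = (w \<otimes> Ident C S) \<cdot> pair ?k (Ident C S)"
    by simp
  then show ?thesis by simp
qed

text \<open>
  Almost sure equality with respect to \<open>\<langle>h, id\<rangle> : S \<rightarrow> D \<otimes> S\<close> can be tested while recording only
  \<open>D\<close>: the \<open>S\<close>-component is a copy of the input, and an equation between morphisms from \<open>S\<close>
  survives recording the input.
\<close>

lemma graph_as_eqI:
  assumes h: "h \<in> Hom C S D" and u: "u \<in> Hom C (D \<otimes>\<^sub>o S) Z" and v: "v \<in> Hom C (D \<otimes>\<^sub>o S) Z"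
    and eq: "pair (proj1 D S) u \<cdot> pair h (Ident C S) = pair (proj1 D S) v \<cdot> pair h (Ident C S)"
  shows "pair (Ident C (D \<otimes>\<^sub>o S)) u \<cdot> pair h (Ident C S)
    = pair (Ident C (D \<otimes>\<^sub>o S)) v \<cdot> pair h (Ident C S)"
proof -
  note [simp] = HomD[OF h] HomD[OF u] HomD[OF v] Hom_Obj[OF h] Hom_Obj[OF u]
  let ?k = "pair h (Ident C S)"
  have w: "pair (pair (proj1 D S) w) (proj2 D S) \<cdot> ?k = pair (pair (proj1 D S) w \<cdot> ?k) (Ident C S)"
    if "w \<in> Hom C (D \<otimes>\<^sub>o S) Z" for w
    using HomD[OF that] by (intro pair_proj2_graph[OF h]) (simp add: Hom_def)
  have "pair (pair (proj1 D S) u) (proj2 D S) \<cdot> ?k = pair (pair (proj1 D S) v) (proj2 D S) \<cdot> ?k"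
    using w[OF u] w[OF v] eq by simp
  then have "pair (pair (proj1 D S) (proj2 D S)) u \<cdot> ?k = pair (pair (proj1 D S) (proj2 D S)) v \<cdot> ?k"
    by (rule pair_rotate) (auto simp: Hom_def)
  then show ?thesis by simp
qed

section \<open>Conditional products\<close>

text \<open>
  The conditional \<open>c : D \<otimes> S \<rightarrow> B\<close> of \<open>q\<close> given the value of \<open>m\<close>. That a sample \<open>b\<close> from \<open>c\<close>
  satisfies \<open>m b = d\<close> almost surely is expressed with \<open>b\<close> recorded, as
  \<open>\<langle>id, m\<rangle> c = \<langle>c, \<pi>\<^sub>1\<rangle>\<close>. This is stronger than \<open>m c = \<pi>\<^sub>1\<close> because \<open>c\<close> is random, and it is
  the form in which \<open>b\<close> can be coupled with further variables.
\<close>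

lemma conditional_of_deterministic_map:
  assumes cond: "has_conditionals C" and q: "q \<in> Hom C S B" and m: "m \<in> Hom (det C) B D"
  shows "\<exists>c \<in> Hom C (D \<otimes>\<^sub>o S) B. c \<cdot> pair (m \<cdot> q) (Ident C S) = q \<and>
    pair (Ident C (D \<otimes>\<^sub>o S)) (pair (Ident C B) m \<cdot> c) \<cdot> pair (m \<cdot> q) (Ident C S)
      = pair (Ident C (D \<otimes>\<^sub>o S)) (pair c (proj1 D S)) \<cdot> pair (m \<cdot> q) (Ident C S)"
proof -
  have m': "m \<in> Hom C B D" and md: "deterministic C m"
    using det_HomD[OF m] by auto
  note [simp] = HomD[OF q] HomD[OF m'] Hom_Obj[OF q] Hom_Obj[OF m'] md
  let ?f = "pair m (Ident C B) \<cdot> q" and ?k = "pair (m \<cdot> q) (Ident C S)"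
  have f: "?f \<in> Hom C S (D \<otimes>\<^sub>o B)" by (simp add: Hom_def)
  then obtain c where "is_conditional C S D B ?f c"
    using cond unfolding has_conditionals_def by (meson Hom_Obj q m')
  from conditional_pair[OF this _ _ _ f] have c: "c \<in> Hom C (D \<otimes>\<^sub>o S) B"
    and fc: "?f = pair (proj1 D S) c \<cdot> ?k"
    by simp_all
  note [simp] = HomD[OF c]
  have qc: "c \<cdot> ?k = q"
    using arg_cong[OF fc, of "\<lambda>u. proj2 D B \<cdot> u"] by simp
  have "pair (proj1 D S) (pair (Ident C B) m \<cdot> c) \<cdot> ?k = (Ident C D \<otimes> pair (Ident C B) m) \<cdot> ?f"
    by (simp add: fc)
  also have "\<dots> = pair m (pair (Ident C B) m) \<cdot> q"
    by simp
  \<comment> \<open>Since \<open>m\<close> is deterministic, its second occurrence may be replaced by a copy of the first.\<close>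
  also have "\<dots> = (Ident C D \<otimes> Swap C D B) \<cdot> (Assoc C D D B \<cdot> ((Copy C D \<otimes> Ident C B) \<cdot> ?f))"
    by (simp add: Copy_det)
  also have "\<dots> = pair (proj1 D S) (pair c (proj1 D S)) \<cdot> ?k"
    unfolding fc by (simp add: Copy_det)
  finally have "pair (Ident C (D \<otimes>\<^sub>o S)) (pair (Ident C B) m \<cdot> c) \<cdot> ?k
      = pair (Ident C (D \<otimes>\<^sub>o S)) (pair c (proj1 D S)) \<cdot> ?k"
    by (intro graph_as_eqI[where Z = "B \<otimes>\<^sub>o D"]) (auto simp: Hom_def)
  with c qc show ?thesis by blast
qed

text \<open>
  Draw \<open>d\<close> from \<open>m q = n p\<close> and then sample both conditionals independently. Jointly with
  the sample, \<open>m \<pi>\<^sub>1\<close> and \<open>n \<pi>\<^sub>2\<close> both reproduce \<open>d\<close>.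
\<close>

lemma conditional_product:
  assumes cond: "has_conditionals C"
    and q: "q \<in> Hom C S B" and p: "p \<in> Hom C S B'"
    and m: "m \<in> Hom (det C) B D" and n: "n \<in> Hom (det C) B' D"
    and eq: "m \<cdot> q = n \<cdot> p"
  shows "\<exists>r \<in> Hom C S (B \<otimes>\<^sub>o B'). proj1 B B' \<cdot> r = q \<and> proj2 B B' \<cdot> r = p \<and>
    as_eq C (B \<otimes>\<^sub>o B') r (m \<cdot> proj1 B B') (n \<cdot> proj2 B B')"
proof -
  have m': "m \<in> Hom C B D" and md: "deterministic C m"
    and n': "n \<in> Hom C B' D" and nd: "deterministic C n"
    using det_HomD[OF m] det_HomD[OF n] by auto
  let ?k = "pair (m \<cdot> q) (Ident C S)" and ?T = "D \<otimes>\<^sub>o S"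
  obtain c where c: "c \<in> Hom C ?T B" and qc: "c \<cdot> ?k = q"
    and mc: "pair (Ident C ?T) (pair (Ident C B) m \<cdot> c) \<cdot> ?k = pair (Ident C ?T) (pair c (proj1 D S)) \<cdot> ?k"
    using conditional_of_deterministic_map[OF cond q m] by blast
  obtain d where d: "d \<in> Hom C ?T B'" and pd: "d \<cdot> ?k = p"
    and nd': "pair (Ident C ?T) (pair (Ident C B') n \<cdot> d) \<cdot> ?k = pair (Ident C ?T) (pair d (proj1 D S)) \<cdot> ?k"
    using conditional_of_deterministic_map[OF cond p n] eq by auto
  note [simp] = HomD[OF q] HomD[OF p] HomD[OF m'] HomD[OF n'] HomD[OF c] HomD[OF d] md nd
    Hom_Obj[OF q] Hom_Obj[OF p] Hom_Obj[OF m']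
  let ?r = "pair c d \<cdot> ?k"
  have r: "?r \<in> Hom C S (B \<otimes>\<^sub>o B')" by (simp add: Hom_def)
  note [simp] = HomD[OF r]
  have "pair (pair (proj1 B B') (m \<cdot> proj1 B B')) (proj2 B B') \<cdot> ?r
      = (pair (Ident C B) m \<otimes> Ident C B') \<cdot> (pair (proj1 B B') (proj2 B B') \<cdot> ?r)"
    by (simp del: pair_proj)
  also have "\<dots> = Swap C B' (B \<otimes>\<^sub>o D) \<cdot> ((d \<otimes> Ident C (B \<otimes>\<^sub>o D))
      \<cdot> (pair (Ident C ?T) (pair (Ident C B) m \<cdot> c) \<cdot> ?k))"
    by simp
  also have "\<dots> = pair (pair c (proj1 D S)) d \<cdot> ?k"
    by (subst mc) simp
  finally have "pair (pair (proj1 B B') (proj2 B B')) (m \<cdot> proj1 B B') \<cdot> ?r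
      = pair (pair c d) (proj1 D S) \<cdot> ?k"
    by (rule pair_rotate) (auto simp: Hom_def)
  then have 1: "pair (Ident C (B \<otimes>\<^sub>o B')) (m \<cdot> proj1 B B') \<cdot> ?r = pair (pair c d) (proj1 D S) \<cdot> ?k"
    by simp
  have "pair (Ident C (B \<otimes>\<^sub>o B')) (n \<cdot> proj2 B B') \<cdot> ?r
      = pair (pair (proj1 B B') (proj2 B B')) (n \<cdot> proj2 B B') \<cdot> ?r"
    by simp
  also have "\<dots> = inv_arr C (Assoc C B B' D)
      \<cdot> ((Ident C B \<otimes> pair (Ident C B') n) \<cdot> (pair (proj1 B B') (proj2 B B') \<cdot> ?r))"
    by (simp del: pair_proj)
  also have "\<dots> = inv_arr C (Assoc C B B' D) \<cdot> ((c \<otimes> Ident C (B' \<otimes>\<^sub>o D))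
      \<cdot> (pair (Ident C ?T) (pair (Ident C B') n \<cdot> d) \<cdot> ?k))"
    by simp
  also have "\<dots> = pair (pair c d) (proj1 D S) \<cdot> ?k"
    by (subst nd') simp
  finally have "as_eq C (B \<otimes>\<^sub>o B') ?r (m \<cdot> proj1 B B') (n \<cdot> proj2 B B')"
    using 1 by (subst as_eq_pair[OF r, of _ D]) (auto simp: Hom_def)
  moreover have "proj1 B B' \<cdot> ?r = q" "proj2 B B' \<cdot> ?r = p"
    using qc pd by simp_all
  ultimately show ?thesis using r by blast
qed

section \<open>The two weak pullbacks in the Markov category\<close>

text \<open>
  The fillers for the two legs of the equalizer \<open>E\<close> of \<open>m \<pi>\<^sub>1\<close> and \<open>n \<pi>\<^sub>2\<close> give one deterministic
  map \<open>t\<close> from \<open>E\<close> to the apex. The randomness of an arbitrary pair \<open>q, p\<close> sits entirely in the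
  factorization of its conditional product through \<open>E\<close>.
\<close>

lemma weak_pullback_det_imp_weak_pullback:
  assumes cond: "has_conditionals C" and ep: "equalizer_principle C"
    and wp: "weak_pullback (det C) f g m n"
  shows "weak_pullback C f g m n"
proof -
  obtain A B B' D where fd: "f \<in> Hom (det C) A B" and gd: "g \<in> Hom (det C) A B'"
    and m: "m \<in> Hom (det C) B D" and n: "n \<in> Hom (det C) B' D" and sq: "m \<cdot> f = n \<cdot> g"
    and fill: "\<And>T q p. T \<in> Obj C \<Longrightarrow> q \<in> Hom (det C) T B \<Longrightarrow> p \<in> Hom (det C) T B'
      \<Longrightarrow> m \<cdot> q = n \<cdot> p \<Longrightarrow> \<exists>r \<in> Hom (det C) T A. f \<cdot> r = q \<and> g \<cdot> r = p"
    using wp unfolding weak_pullback_def det_simps by blast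
  note f' = det_HomD[OF fd] and g' = det_HomD[OF gd] and m' = det_HomD[OF m] and n' = det_HomD[OF n]
  note [simp] = HomD[OF f'(1)] HomD[OF g'(1)] HomD[OF m'(1)] HomD[OF n'(1)] f'(2) g'(2) m'(2) n'(2)
    Hom_Obj[OF f'(1)] Hom_Obj[OF g'(1)] Hom_Obj[OF m'(1)]
  let ?p1 = "proj1 B B'" and ?p2 = "proj2 B B'" and ?BB = "B \<otimes>\<^sub>o B'"
  have mp: "m \<cdot> ?p1 \<in> Hom (det C) ?BB D" and np: "n \<cdot> ?p2 \<in> Hom (det C) ?BB D"
    by (auto intro!: det_HomI simp: Hom_def)
  obtain E e where E: "is_equalizer (det C) ?BB D (m \<cdot> ?p1) (n \<cdot> ?p2) E e"
    using ep mp np unfolding equalizer_principle_def has_equalizers_def by (metis Hom_Obj det_HomD(1) det_simps(1))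
  then have ed: "e \<in> Hom (det C) E ?BB" and ee: "(m \<cdot> ?p1) \<cdot> e = (n \<cdot> ?p2) \<cdot> e"
    by (auto simp: is_equalizer_def)
  note e' = det_HomD[OF ed]
  note [simp] = HomD[OF e'(1)] e'(2) Hom_Obj[OF e'(1)]
  have "\<exists>t \<in> Hom (det C) E A. f \<cdot> t = ?p1 \<cdot> e \<and> g \<cdot> t = ?p2 \<cdot> e"
    using ee by (intro fill) (auto intro!: det_HomI simp: Hom_def)
  then obtain t where t: "t \<in> Hom C E A" and ft: "f \<cdot> t = ?p1 \<cdot> e" and gt: "g \<cdot> t = ?p2 \<cdot> e"
    using det_HomD(1) by blast
  note [simp] = HomD[OF t]
  have "\<exists>r \<in> Hom C S A. f \<cdot> r = q \<and> g \<cdot> r = p"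
    if q: "q \<in> Hom C S B" and p: "p \<in> Hom C S B'" and eq: "m \<cdot> q = n \<cdot> p" for S q p
  proof -
    obtain r where r: "r \<in> Hom C S ?BB" "?p1 \<cdot> r = q" "?p2 \<cdot> r = p"
      and ae: "as_eq C ?BB r (m \<cdot> ?p1) (n \<cdot> ?p2)"
      using conditional_product[OF cond q p m n eq] by blast
    obtain s where s: "s \<in> Hom C S E" "e \<cdot> s = r"
      using ep E r(1) ae Hom_Obj[OF q] unfolding equalizer_principle_def by blast
    note [simp] = HomD[OF s(1)] HomD[OF r(1)]
    have "f \<cdot> (t \<cdot> s) = q" "g \<cdot> (t \<cdot> s) = p"
      using comp_assoc_rewrite[OF ft, of s] comp_assoc_rewrite[OF gt, of s] r s by simp_all
    moreover have "t \<cdot> s \<in> Hom C S A" by (simp add: Hom_def)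
    ultimately show ?thesis by blast
  qed
  then show ?thesis
    unfolding weak_pullback_def using f'(1) g'(1) m'(1) n'(1) sq by blast
qed

text \<open>
  The conditional product is taken over \<open>Y\<close>, with \<open>\<langle>id, samp\<rangle> q : S \<rightarrow> P Y \<otimes> Y\<close> in place of \<open>q\<close>:
  the map \<open>\<pi>\<^sub>2\<close> that forgets the distribution is deterministic, whereas \<open>samp\<close> is in general not.
\<close>

lemma samp_square_weak_pullback:
  assumes cond: "has_conditionals C" and asrep: "as_compatibly_represented_by C P samp"
    and fd: "f \<in> Hom (det C) X Y"
  shows "weak_pullback C (dist_map C P samp f) (samp X) (samp Y) f"
proof -
  have rep: "represented_by C P samp"
    and ascomp: "\<And>\<Theta> A Z p u v. p \<in> Hom C \<Theta> A \<Longrightarrow> u \<in> Hom C A Z \<Longrightarrow> v \<in> Hom C A Z \<Longrightarrow> as_eq C A p u v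
      \<Longrightarrow> as_eq C A p (sharp C P samp u) (sharp C P samp v)"
    using asrep Hom_Obj unfolding as_compatibly_represented_by_def by blast+
  note f = det_HomD[OF fd]
  have X: "X \<in> Obj C" and Y: "Y \<in> Obj C" using Hom_Obj[OF f(1)] by auto
  note sX = samp_Hom[OF rep X] and sY = samp_Hom[OF rep Y]
  note Pf = det_HomD[OF dist_map_Hom[OF rep f(1)]]
  note [simp] = HomD[OF f(1)] f(2) X Y HomD[OF sX] HomD[OF sY] HomD[OF Pf(1)] Pf(2)
    Hom_Obj[OF sX] Hom_Obj[OF sY]
  have "\<exists>r \<in> Hom C S (P X). dist_map C P samp f \<cdot> r = q \<and> samp X \<cdot> r = p"
    if q: "q \<in> Hom C S (P Y)" and p: "p \<in> Hom C S X" and eq: "samp Y \<cdot> q = f \<cdot> p" for S q p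
  proof -
    note [simp] = HomD[OF q] HomD[OF p] Hom_Obj[OF q]
    let ?B = "P Y \<otimes>\<^sub>o Y" and ?q = "pair (Ident C (P Y)) (samp Y) \<cdot> q"
    have "?q \<in> Hom C S ?B" "proj2 (P Y) Y \<in> Hom (det C) ?B Y" "proj2 (P Y) Y \<cdot> ?q = f \<cdot> p"
      using eq by (auto intro!: det_HomI simp: Hom_def)
    from conditional_product[OF cond this(1) p this(2) fd this(3)]
    obtain r where r: "r \<in> Hom C S (?B \<otimes>\<^sub>o X)" "proj1 ?B X \<cdot> r = ?q" "proj2 ?B X \<cdot> r = p"
      and ae: "as_eq C (?B \<otimes>\<^sub>o X) r (proj2 (P Y) Y \<cdot> proj1 ?B X) (f \<cdot> proj2 ?B X)"
      by blast
    note [simp] = HomD[OF r(1)]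
    have ae': "pair (Ident C (?B \<otimes>\<^sub>o X)) (proj2 (P Y) Y \<cdot> proj1 ?B X) \<cdot> r
        = pair (Ident C (?B \<otimes>\<^sub>o X)) (f \<cdot> proj2 ?B X) \<cdot> r"
      using ae by (subst (asm) as_eq_pair[OF r(1), of _ Y]) (auto simp: Hom_def)
    \<comment> \<open>The coupling of the distribution on \<open>Y\<close> with the point of \<open>X\<close>, the sample being forgotten;
      its conditional \<open>c\<close> turns a distribution on \<open>Y\<close> and the input from \<open>S\<close> into a distribution
      on \<open>X\<close>, which almost surely lies above the given one.\<close>
    let ?u = "pair (proj1 (P Y) Y \<cdot> proj1 ?B X) (proj2 ?B X) \<cdot> r"
    have u: "?u \<in> Hom C S (P Y \<otimes>\<^sub>o X)" by (simp add: Hom_def)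
    have uq: "proj1 (P Y) X \<cdot> ?u = q" using r(2) by simp
    obtain c where "is_conditional C S (P Y) X ?u c"
      using cond u unfolding has_conditionals_def by (meson Hom_Obj q p)
    from conditional_pair[OF this _ _ _ u] uq have c: "c \<in> Hom C (P Y \<otimes>\<^sub>o S) X"
      and uc: "?u = pair (proj1 (P Y) S) c \<cdot> pair q (Ident C S)"
      by simp_all
    note [simp] = HomD[OF c]
    let ?j = "pair q (Ident C S)" and ?T = "P Y \<otimes>\<^sub>o S"
    have j: "?j \<in> Hom C S ?T" by (simp add: Hom_def)
    \<comment> \<open>Pushing the \<open>X\<close>-component forward along \<open>f\<close> recovers the forgotten sample.\<close>
    have "pair (proj1 (P Y) S) (f \<cdot> c) \<cdot> ?j = (Ident C (P Y) \<otimes> f) \<cdot> ?u"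
      unfolding uc by simp
    also have "\<dots> = ((proj1 (P Y) Y \<cdot> proj1 ?B X) \<otimes> Ident C Y)
        \<cdot> (pair (Ident C (?B \<otimes>\<^sub>o X)) (f \<cdot> proj2 ?B X) \<cdot> r)"
      by simp
    also have "\<dots> = pair (proj1 (P Y) Y) (proj2 (P Y) Y) \<cdot> (proj1 ?B X \<cdot> r)"
      unfolding ae'[symmetric] by (subst comp_assoc[symmetric]) (simp_all del: pair_proj comp_assoc)
    also have "\<dots> = pair (proj1 (P Y) S) (samp Y \<cdot> proj1 (P Y) S) \<cdot> ?j"
    proof -
      have "pair (Ident C (P Y)) (samp Y) \<cdot> (proj1 (P Y) S \<cdot> ?j)
          = pair (proj1 (P Y) S) (samp Y \<cdot> proj1 (P Y) S) \<cdot> ?j"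
        by (subst comp_assoc[symmetric]) (simp_all del: comp_assoc)
      then show ?thesis using r(2) by simp
    qed
    finally have "pair (Ident C ?T) (f \<cdot> c) \<cdot> ?j = pair (Ident C ?T) (samp Y \<cdot> proj1 (P Y) S) \<cdot> ?j"
      by (intro graph_as_eqI[OF q, where Z = Y]) (auto simp: Hom_def)
    moreover have fc: "f \<cdot> c \<in> Hom C ?T Y" and sp: "samp Y \<cdot> proj1 (P Y) S \<in> Hom C ?T Y"
      by (auto simp: Hom_def)
    ultimately have "as_eq C ?T ?j (f \<cdot> c) (samp Y \<cdot> proj1 (P Y) S)"
      using as_eq_pair[OF j] by blast
    from ascomp[OF j fc sp this]
    have ae2: "as_eq C ?T ?j (sharp C P samp (f \<cdot> c)) (sharp C P samp (samp Y \<cdot> proj1 (P Y) S))" .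
    have p1: "proj1 (P Y) S \<in> Hom (det C) ?T (P Y)"
      by (auto intro!: det_HomI simp: Hom_def)
    have sharp_sp: "sharp C P samp (samp Y \<cdot> proj1 (P Y) S) = proj1 (P Y) S"
      using samp_cancel[OF rep sharp_Hom[OF rep sp] p1 Y] samp_sharp[OF rep sp] by simp
    let ?c = "sharp C P samp c"
    note cs = sharp_Hom[OF rep c] and cs' = det_HomD[OF sharp_Hom[OF rep c]]
    note [simp] = HomD[OF cs'(1)]
    have "samp Y \<cdot> (dist_map C P samp f \<cdot> ?c) = f \<cdot> c"
      using comp_assoc_rewrite[OF samp_dist_map[OF rep f(1)], of ?c] samp_sharp[OF rep c] by simp
    then have sharp_fc: "sharp C P samp (f \<cdot> c) = dist_map C P samp f \<cdot> ?c"
      using samp_cancel[OF rep sharp_Hom[OF rep fc] det_Comp_Hom[OF cs dist_map_Hom[OF rep f(1)]] Y]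
        samp_sharp[OF rep fc] by simp
    have "pair (Ident C ?T) (dist_map C P samp f \<cdot> ?c) \<cdot> ?j = pair (Ident C ?T) (proj1 (P Y) S) \<cdot> ?j"
      using ae2 unfolding sharp_sp sharp_fc
      by (subst (asm) as_eq_pair[OF j, of _ "P Y"]) (auto simp: Hom_def)
    from arg_cong[OF this, of "\<lambda>w. proj2 ?T (P Y) \<cdot> w"]
    have "dist_map C P samp f \<cdot> (?c \<cdot> ?j) = q" by simp
    moreover have "samp X \<cdot> (?c \<cdot> ?j) = p"
      using comp_assoc_rewrite[OF samp_sharp[OF rep c], of ?j] arg_cong[OF uc, of "\<lambda>w. proj2 (P Y) X \<cdot> w"] r(3)
      by simp
    moreover have "?c \<cdot> ?j \<in> Hom C S (P X)" by (simp add: Hom_def)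
    ultimately show ?thesis by blast
  qed
  then show ?thesis
    unfolding weak_pullback_def using Pf(1) sX sY f(1) samp_dist_map[OF rep f(1)] by blast
qed

section \<open>The distribution functor on weak pullbacks\<close>

text \<open>
  The adjunction turns cones of deterministic maps over the image square into cones of arbitrary
  maps over the original one, and fillers of the latter back into deterministic fillers.
\<close>

lemma dist_map_weak_pullback:
  assumes rep: "represented_by C P samp" and wp: "weak_pullback C f g m n"
  shows "weak_pullback (det C) (dist_map C P samp f) (dist_map C P samp g)
    (dist_map C P samp m) (dist_map C P samp n)"
proof -
  let ?P = "dist_map C P samp"
  obtain A B B' D where f: "f \<in> Hom C A B" and g: "g \<in> Hom C A B'"
    and m: "m \<in> Hom C B D" and n: "n \<in> Hom C B' D" and sq: "m \<cdot> f = n \<cdot> g"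
    and fill: "\<And>T q p. T \<in> Obj C \<Longrightarrow> q \<in> Hom C T B \<Longrightarrow> p \<in> Hom C T B'
      \<Longrightarrow> m \<cdot> q = n \<cdot> p \<Longrightarrow> \<exists>r \<in> Hom C T A. f \<cdot> r = q \<and> g \<cdot> r = p"
    using wp unfolding weak_pullback_def by blast
  note [simp] = HomD[OF f] HomD[OF g] HomD[OF m] HomD[OF n] Hom_Obj[OF f] Hom_Obj[OF g] Hom_Obj[OF m]
  have s [simp]: "samp X \<in> Arr C" "Dom C (samp X) = P X" "Cod C (samp X) = X" if "X \<in> Obj C" for X
    using HomD[OF samp_Hom[OF rep that]] by auto
  have samp_map: "samp Y \<cdot> (?P h \<cdot> r) = h \<cdot> (samp X \<cdot> r)"
    if h: "h \<in> Hom C X Y" and r: "r \<in> Hom C S (P X)" for h r X Y S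
    using comp_assoc_rewrite[OF samp_dist_map[OF rep h], of r] HomD[OF h] HomD[OF r] Hom_Obj[OF h]
      HomD[OF det_Hom[OF rep dist_map_Hom[OF rep h]]]
    by simp
  have cancel: "?P h \<cdot> sharp C P samp r = q"
    if h: "h \<in> Hom C X Y" and r: "r \<in> Hom C S X" and q: "q \<in> Hom (det C) S (P Y)"
      and eq: "h \<cdot> r = samp Y \<cdot> q" for h r q X Y S
    using samp_cancel[OF rep det_Comp_Hom[OF sharp_Hom[OF rep r] dist_map_Hom[OF rep h]] q Hom_Obj(2)[OF h]]
      samp_map[OF h det_Hom[OF rep sharp_Hom[OF rep r]]] samp_sharp[OF rep r] eq
    by simp
  have "\<exists>r \<in> Hom (det C) S (P A). ?P f \<cdot> r = q \<and> ?P g \<cdot> r = p"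
    if q: "q \<in> Hom (det C) S (P B)" and p: "p \<in> Hom (det C) S (P B')"
      and eq: "?P m \<cdot> q = ?P n \<cdot> p" for S q p
  proof -
    note q' = det_HomD(1)[OF q] and p' = det_HomD(1)[OF p]
    note [simp] = HomD[OF q'] HomD[OF p']
    have "m \<cdot> (samp B \<cdot> q) = n \<cdot> (samp B' \<cdot> p)"
      using samp_map[OF m q'] samp_map[OF n p'] eq by simp
    then obtain r where r: "r \<in> Hom C S A" "f \<cdot> r = samp B \<cdot> q" "g \<cdot> r = samp B' \<cdot> p"
      using fill[of S "samp B \<cdot> q" "samp B' \<cdot> p"] Hom_Obj[OF q'] by (auto simp: Hom_def)
    then show ?thesis
      using sharp_Hom[OF rep r(1)] cancel[OF f r(1) q r(2)] cancel[OF g r(1) p r(3)] by blast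
  qed
  moreover have "?P m \<cdot> ?P f = ?P n \<cdot> ?P g"
    using sq dist_map_Comp[OF rep f m] dist_map_Comp[OF rep g n] by simp
  ultimately show ?thesis
    unfolding weak_pullback_def det_simps
    using dist_map_Hom[OF rep f] dist_map_Hom[OF rep g] dist_map_Hom[OF rep m] dist_map_Hom[OF rep n]
    by blast
qed

end

theorem corollary3p8:
  fixes C :: "('o, 'm) markov_category"
    and P :: "'o \<Rightarrow> 'o" and samp :: "'o \<Rightarrow> 'm"
  assumes "markov_category C"
    and "as_compatibly_represented_by C P samp"
    and "has_conditionals C"
    and "equalizer_principle C"
  shows "weakly_cartesian_functor (det C) (dist_monad C P samp) \<and>
         weakly_cartesian_mult (det C) (dist_monad C P samp)"
proof -
  interpret markov_category C by fact
  have rep: "represented_by C P samp"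
    using assms(2) by (simp add: as_compatibly_represented_by_def)
  show ?thesis
    unfolding weakly_cartesian_functor_def weakly_cartesian_mult_def
    using dist_map_weak_pullback[OF rep] weak_pullback_det_imp_weak_pullback[OF assms(3,4)]
      samp_square_weak_pullback[OF assms(3,2)]
    by (auto simp: dist_monad_def)
qed

end
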